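(* Let $\mathfrak g=\mathfrak g_{-k}\oplus\cdots\oplus\mathfrak g_{-1}\oplus\mathfrak g_0$ be a non-positively graded fundamental Lie algebra and $\mathfrak h=t^*(\mathfrak g)$ its cotangent Lie algebra, with its induced gradation. Let the spaces $\mathcal S(\mathfrak g)$, $Z_l(\mathfrak g)$, $B_l(\mathfrak g)$ ($l\ge1$) be as defined in the context. Then $$H^1_1(\mathfrak h_-,\mathfrak h)=\mathcal S(\mathfrak g)\oplus Z_1(\mathfrak g)/B_1(\mathfrak g),\qquad H^1_l(\mathfrak h_-,\mathfrak h)=Z_l(\mathfrak g)/B_l(\mathfrak g),\quad l\ge2$$ (equality meaning isomorphism of vector spaces).
   Context: Fundamental gradation: $[\mathfrak g_i,\mathfrak g_j]\subset\mathfrak g_{i+j}$ ($\mathfrak g_i=0$ for $i<-k$ or $i>0$), $k>0$, $\mathfrak g_-=\mathfrak g_{-k}\oplus\cdots\oplus\mathfrak g_{-1}$ is generated by $\mathfrak g_{-1}$, $\mathfrak g_0$ and $\mathfrak g_{-k}$ are non-trivial, and the adjoint action of $\mathfrak g_0$ on $\mathfrak g_{-1}$ is exact (faithful). Lie algebras are finite dimensional. $\mathfrak g^*$ has the gradation $(\mathfrak g^* )_i=(\mathfrak g_{-i})^*$. For $X\in\mathfrak g$, $L_X(\alpha)(Y)=-\alpha([X,Y])$ is the coadjoint action on $\mathfrak g^*$. The cotangent Lie algebra is $\mathfrak h=t^*(\mathfrak g)=\mathfrak g\oplus\mathfrak g^*$ with bracket $[X+\xi,Y+\eta]=[X,Y]+L_X(\eta)-L_Y(\xi)$;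 its gradation is $\mathfrak h_i=\mathfrak g_i$ ($i<0$), $\mathfrak h_0=\mathfrak g_0\oplus(\mathfrak g_0)^*$, $\mathfrak h_i=(\mathfrak g_{-i})^*$ ($i>0$). So $\mathfrak h_-=\mathfrak g_-$. $C^p(\mathfrak h_-,\mathfrak h)=\Lambda^p(\mathfrak h_-^* )\otimes\mathfrak h$ with the Lie algebra (Chevalley–Eilenberg) differential $\partial$ for the adjoint action of $\mathfrak h_-$ on $\mathfrak h$; $C^p_l$ is the subspace of forms of homogeneous degree $l$ (mapping $\mathfrak h_{s_1}\times\cdots\times\mathfrak h_{s_p}$ to $\mathfrak h_{s_1+\cdots+s_p+l}$), $\partial$ preserves the degree, and $H^1_l(\mathfrak h_-,\mathfrak h)=\ker(\partial:C^1_l\to C^2_l)/\partial(C^0_l)$, $C^0_l=\mathfrak h_l$. $\mathcal S(\mathfrak g)\subset\mathrm{Hom}(\mathfrak g_{-1},\mathfrak g_0)$ is the vector space of all linear $f:\mathfrak g_{-1}\to\mathfrak g_0$ such that: for any $X_1,\dots,X_s,X'_1,\dots,X'_s\in\mathfrak g_{-1}$ with $\mathrm{ad}_{X_1}\cdots\mathrm{ad}_{X_{s-1}}(X_s)=\mathrm{ad}_{X'_1}\cdots\mathrm{ad}_{X'_{s-1}}(X'_s)$, the following holds: $$\mathrm{ad}_{f(X_1)}\mathrm{ad}_{X_2}\cdots\mathrm{ad}_{X_{s-1}}(X_s)+\cdots+\mathrm{ad}_{X_1}\cdots\mathrm{ad}_{f(X_{s-1})}(X_s)+\mathrm{ad}_{X_1}\cdots\mathrm{ad}_{X_{s-1}}f(X_s)$$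 $$=\mathrm{ad}_{f(X'_1)}\mathrm{ad}_{X'_2}\cdots\mathrm{ad}_{X'_{s-1}}(X'_s)+\cdots+\mathrm{ad}_{X'_1}\cdots\mathrm{ad}_{f(X'_{s-1})}(X'_s)+\mathrm{ad}_{X'_1}\cdots\mathrm{ad}_{X'_{s-1}}f(X'_s).$$ $Z_1(\mathfrak g)=\mathrm{Hom}(\mathfrak g_{-1},(\mathfrak g_0)^* )$. For $l\ge2$, $Z_l(\mathfrak g)\subset\mathrm{Hom}(\mathfrak g_{-1},(\mathfrak g_{1-l})^* )$ is the vector space of all linear $\alpha$ such that: for any $X_1,\dots,X_s,X'_1,\dots,X'_s\in\mathfrak g_{-1}$ ($2\le s\le l$) with $\mathrm{ad}_{X_1}\cdots\mathrm{ad}_{X_{s-1}}(X_s)=\mathrm{ad}_{X'_1}\cdots\mathrm{ad}_{X'_{s-1}}(X'_s)$, the following holds: $$\sum_{i=1}^s(-1)^{i+1}\alpha(X_i)\,\mathrm{ad}_{\mathrm{ad}_{X_{i+1}}\cdots\mathrm{ad}_{X_{s-1}}(X_s)}\,\mathrm{ad}_{X_{i-1}}\cdots\mathrm{ad}_{X_1}|_{\mathfrak g_{s-l}}=\sum_{i=1}^s(-1)^{i+1}\alpha(X'_i)\,\mathrm{ad}_{\mathrm{ad}_{X'_{i+1}}\cdots\mathrm{ad}_{X'_{s-1}}(X'_s)}\,\mathrm{ad}_{X'_{i-1}}\cdots\mathrm{ad}_{X'_1}|_{\mathfrak g_{s-l}}.$$ Here products are compositions; for $i=s$ the factor $\mathrm{ad}_{\mathrm{ad}_{X_{s+1}}\cdots}$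 is omitted, and for $i=s-1$ it is $\mathrm{ad}_{X_s}$. For $l\ge1$, $B_l(\mathfrak g)=\{\hat\beta:\mathfrak g_{-1}\to(\mathfrak g_{1-l})^*,\ \beta\in(\mathfrak g_{-l})^*\}$, where $\hat\beta(X)(Z):=-\beta([X,Z])$ for $X\in\mathfrak g_{-1}$, $Z\in\mathfrak g_{1-l}$.
   Formalization: In S(g) and Z_l(g) the condition is imposed on equal finite sums of monomials ad_{X_1}...ad_{X_{s-1}}(X_s), not only on two equal single monomials; with single monomials the claim fails, e.g. g_{-1}=V of dim 6, g_{-2}=Λ²V/<ω> with ω of rank 6, g_0 spanned by the grading element, l=2. *)

theory Defs
  imports Complex_Main "HOL-Library.Function_Algebras" "HOL-Library.Product_Plus" "HOL-Library.Set_Algebras"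
begin

section \<open>Vector spaces as structures, quotients and direct sums\<close>

record ('k, 'v) vspace =
  vcarrier :: "'v set"
  vadd :: "'v \<Rightarrow> 'v \<Rightarrow> 'v"
  vsmult :: "'k \<Rightarrow> 'v \<Rightarrow> 'v"

definition as_vspace :: "('k \<Rightarrow> 'v \<Rightarrow> 'v) \<Rightarrow> 'v::ab_group_add set \<Rightarrow> ('k, 'v) vspace" where
  "as_vspace sc V = \<lparr>vcarrier = V, vadd = (+), vsmult = sc\<rparr>"

text \<open>The elements of \<open>V/W\<close> are the cosets \<open>v + W\<close>. Addition is addition of sets; in the scalar
  multiplication \<open>W\<close> is added so that \<open>0 \<cdot> (v + W)\<close> is \<open>W\<close> and not \<open>{0}\<close>.\<close>

definition vquotient ::
  "('k \<Rightarrow> 'v \<Rightarrow> 'v) \<Rightarrow> 'v::ab_group_add set \<Rightarrow> 'v set \<Rightarrow> ('k, 'v set) vspace" where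
  "vquotient sc V W =
     \<lparr>vcarrier = (\<lambda>v. v +o W) ` V, vadd = (\<lambda>A B. A + B), vsmult = (\<lambda>c A. sc c ` A + W)\<rparr>"

definition vsum :: "('k, 'v) vspace \<Rightarrow> ('k, 'w) vspace \<Rightarrow> ('k, 'v \<times> 'w) vspace" where
  "vsum E F =
     \<lparr>vcarrier = vcarrier E \<times> vcarrier F,
      vadd = (\<lambda>(x, y) (x', y'). (vadd E x x', vadd F y y')),
      vsmult = (\<lambda>c (x, y). (vsmult E c x, vsmult F c y))\<rparr>"

definition vs_iso :: "('k, 'v) vspace \<Rightarrow> ('k, 'w) vspace \<Rightarrow> bool" where
  "vs_iso E F \<longleftrightarrow>
     (\<exists>T. bij_betw T (vcarrier E) (vcarrier F) \<and>
          (\<forall>x\<in>vcarrier E. \<forall>y\<in>vcarrier E. T (vadd E x y) = vadd F (T x) (T y)) \<and>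
          (\<forall>c. \<forall>x\<in>vcarrier E. T (vsmult E c x) = vsmult F c (T x)))"

definition fun_scale :: "('k \<Rightarrow> 'v \<Rightarrow> 'v) \<Rightarrow> 'k \<Rightarrow> ('x \<Rightarrow> 'v) \<Rightarrow> 'x \<Rightarrow> 'v" where
  "fun_scale sc c f = (\<lambda>x. sc c (f x))"

text \<open>\<open>Hom(U, V)\<close> for subspaces \<open>U\<close>, \<open>V\<close>: a linear map on \<open>U\<close> is represented by its extension by
  \<open>0\<close> outside \<open>U\<close>, so that equality of maps on \<open>U\<close> is equality of functions.\<close>

definition Hom ::
  "('k \<Rightarrow> 'v \<Rightarrow> 'v) \<Rightarrow> ('k \<Rightarrow> 'w \<Rightarrow> 'w) \<Rightarrow> 'v::ab_group_add set \<Rightarrow> 'w::ab_group_add set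
    \<Rightarrow> ('v \<Rightarrow> 'w) set" where
  "Hom s1 s2 U V =
     {f. (\<forall>x\<in>U. f x \<in> V) \<and>
         (\<forall>x\<in>U. \<forall>y\<in>U. f (x + y) = f x + f y) \<and>
         (\<forall>c. \<forall>x\<in>U. f (s1 c x) = s2 c (f x)) \<and>
         (\<forall>x. x \<notin> U \<longrightarrow> f x = 0)}"

section \<open>Fundamental non-positively graded Lie algebras\<close>

locale lie_algebra = vector_space scale
  for scale :: "'k::field \<Rightarrow> 'a::ab_group_add \<Rightarrow> 'a" +
  fixes bracket :: "'a \<Rightarrow> 'a \<Rightarrow> 'a"
  assumes linear_left: "Vector_Spaces.linear scale scale (\<lambda>x. bracket x y)"
    and linear_right: "Vector_Spaces.linear scale scale (\<lambda>y. bracket x y)"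
    and alternating: "bracket x x = 0"
    and jacobi: "bracket x (bracket y z) + bracket y (bracket z x) + bracket z (bracket x y) = 0"
    and finite_dim: "\<exists>B. finite B \<and> span B = UNIV"

definition lie_subalgebra ::
  "('k::field \<Rightarrow> 'a \<Rightarrow> 'a) \<Rightarrow> ('a \<Rightarrow> 'a \<Rightarrow> 'a) \<Rightarrow> 'a::ab_group_add set \<Rightarrow> bool" where
  "lie_subalgebra scale bracket A \<longleftrightarrow>
     module.subspace scale A \<and> (\<forall>x\<in>A. \<forall>y\<in>A. bracket x y \<in> A)"

definition negative_part ::
  "('k::field \<Rightarrow> 'a \<Rightarrow> 'a) \<Rightarrow> (int \<Rightarrow> 'a::ab_group_add set) \<Rightarrow> 'a set" where
  "negative_part scale G = module.span scale (\<Union>i\<in>{..<0}. G i)"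

locale fundamental_lie_algebra = lie_algebra scale bracket
  for scale :: "'k::field \<Rightarrow> 'a::ab_group_add \<Rightarrow> 'a" and bracket +
  fixes k :: int and G :: "int \<Rightarrow> 'a set"
  assumes k_pos: "k > 0"
    and subspace_G: "subspace (G i)"
    and G_outside: "i < - k \<or> i > 0 \<Longrightarrow> G i = {0}"
    and direct_sum: "\<exists>!c. (\<forall>i. c i \<in> G i) \<and> x = (\<Sum>i\<in>{- k..0}. c i)"
    and bracket_G: "x \<in> G i \<Longrightarrow> y \<in> G j \<Longrightarrow> bracket x y \<in> G (i + j)"
    and generated: "lie_subalgebra scale bracket hull G (- 1) = negative_part scale G"
    and G_0_nontrivial: "G 0 \<noteq> {0}"
    and G_lowest_nontrivial: "G (- k) \<noteq> {0}"
    and faithful: "a \<in> G 0 \<Longrightarrow> (\<forall>x\<in>G (- 1). bracket a x = 0) \<Longrightarrow> a = 0"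

section \<open>The cotangent Lie algebra\<close>

definition dual :: "('k::field \<Rightarrow> 'a \<Rightarrow> 'a) \<Rightarrow> ('a::ab_group_add \<Rightarrow> 'k) set" where
  "dual scale = {\<xi>. Vector_Spaces.linear scale (*) \<xi>}"

text \<open>\<open>(g\<^sub>j)\<^sup>*\<close> as a subspace of \<open>g\<^sup>*\<close>, i.e. the homogeneous component \<open>(g\<^sup>*)\<^sub>-\<^sub>j\<close>: a functional on
  \<open>g\<^sub>j\<close> is extended by \<open>0\<close> to the other homogeneous components of \<open>g\<close>.\<close>

definition dual_comp ::
  "('k::field \<Rightarrow> 'a \<Rightarrow> 'a) \<Rightarrow> (int \<Rightarrow> 'a set) \<Rightarrow> int \<Rightarrow> ('a::ab_group_add \<Rightarrow> 'k) set" where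
  "dual_comp scale G j = {\<xi>\<in>dual scale. \<forall>i. i \<noteq> j \<longrightarrow> (\<forall>x\<in>G i. \<xi> x = 0)}"

definition coad ::
  "('a \<Rightarrow> 'a \<Rightarrow> 'a) \<Rightarrow> 'a \<Rightarrow> ('a \<Rightarrow> 'k::field) \<Rightarrow> 'a \<Rightarrow> 'k" where
  "coad bracket x \<xi> = (\<lambda>y. - \<xi> (bracket x y))"

text \<open>\<open>t\<^sup>*(g) = g \<oplus> g\<^sup>*\<close> is the subset \<open>UNIV \<times> dual scale\<close> of the type of pairs.\<close>

definition cot_scale ::
  "('k::field \<Rightarrow> 'a \<Rightarrow> 'a) \<Rightarrow> 'k \<Rightarrow> 'a \<times> ('a \<Rightarrow> 'k) \<Rightarrow> 'a \<times> ('a \<Rightarrow> 'k)" where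
  "cot_scale scale c = (\<lambda>(x, \<xi>). (scale c x, fun_scale (*) c \<xi>))"

definition cot_bracket ::
  "('a \<Rightarrow> 'a \<Rightarrow> 'a) \<Rightarrow> 'a \<times> ('a \<Rightarrow> 'k::field) \<Rightarrow> 'a \<times> ('a \<Rightarrow> 'k) \<Rightarrow> 'a \<times> ('a \<Rightarrow> 'k)" where
  "cot_bracket bracket =
     (\<lambda>(x, \<xi>) (y, \<eta>). (bracket x y, coad bracket x \<eta> - coad bracket y \<xi>))"

definition cot_grading ::
  "('k::field \<Rightarrow> 'a \<Rightarrow> 'a) \<Rightarrow> (int \<Rightarrow> 'a::ab_group_add set) \<Rightarrow> int \<Rightarrow> ('a \<times> ('a \<Rightarrow> 'k)) set" where
  "cot_grading scale G i =
     (if i < 0 then G i \<times> {0}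
      else if i = 0 then G 0 \<times> dual_comp scale G 0
      else {0} \<times> dual_comp scale G (- i))"

section \<open>Cohomology of the negative part with values in the adjoint module\<close>

text \<open>For a Lie algebra with gradation \<open>H\<close>, a \<open>p\<close>-cochain is an alternating \<open>p\<close>-linear map from the
  negative part to the whole Lie algebra, given as a function of the list of its arguments and
  extended by \<open>0\<close> to all other lists.\<close>

definition cochains ::
  "('k::field \<Rightarrow> 'b \<Rightarrow> 'b) \<Rightarrow> (int \<Rightarrow> 'b::ab_group_add set) \<Rightarrow> nat \<Rightarrow> ('b list \<Rightarrow> 'b) set" where
  "cochains sc H p =
     {\<omega>. (\<forall>xs. \<not> (length xs = p \<and> set xs \<subseteq> negative_part sc H) \<longrightarrow> \<omega> xs = 0) \<and>
         (\<forall>xs. length xs = p \<and> set xs \<subseteq> negative_part sc H \<longrightarrow>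
            \<omega> xs \<in> module.span sc (\<Union>i. H i) \<and>
            (\<forall>i<p. (\<lambda>x. if x \<in> negative_part sc H then \<omega> (xs[i := x]) else 0)
                     \<in> Hom sc sc (negative_part sc H) UNIV) \<and>
            (\<forall>i<p. \<forall>j<p. i \<noteq> j \<and> xs ! i = xs ! j \<longrightarrow> \<omega> xs = 0))}"

definition cochains_deg ::
  "('k::field \<Rightarrow> 'b \<Rightarrow> 'b) \<Rightarrow> (int \<Rightarrow> 'b::ab_group_add set) \<Rightarrow> nat \<Rightarrow> int \<Rightarrow> ('b list \<Rightarrow> 'b) set" where
  "cochains_deg sc H p l =
     {\<omega>\<in>cochains sc H p. \<forall>ss xs. length ss = p \<and> list_all2 (\<lambda>s x. s < 0 \<and> x \<in> H s) ss xs
        \<longrightarrow> \<omega> xs \<in> H (sum_list ss + l)}"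

definition drop_nth :: "nat \<Rightarrow> 'b list \<Rightarrow> 'b list" where
  "drop_nth i xs = take i xs @ drop (Suc i) xs"

definition ce_diff ::
  "('k::field \<Rightarrow> 'b \<Rightarrow> 'b) \<Rightarrow> ('b \<Rightarrow> 'b \<Rightarrow> 'b) \<Rightarrow> (int \<Rightarrow> 'b::ab_group_add set)
    \<Rightarrow> ('b list \<Rightarrow> 'b) \<Rightarrow> 'b list \<Rightarrow> 'b" where
  "ce_diff sc br H \<omega> xs =
     (if set xs \<subseteq> negative_part sc H then
        (\<Sum>i<length xs. sc ((- 1) ^ i) (br (xs ! i) (\<omega> (drop_nth i xs)))) +
        (\<Sum>(i, j)\<in>{(i, j). i < j \<and> j < length xs}.
           sc ((- 1) ^ (i + j)) (\<omega> (br (xs ! i) (xs ! j) # drop_nth i (drop_nth j xs))))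
      else 0)"

definition cohomology ::
  "('k::field \<Rightarrow> 'b \<Rightarrow> 'b) \<Rightarrow> ('b \<Rightarrow> 'b \<Rightarrow> 'b) \<Rightarrow> (int \<Rightarrow> 'b::ab_group_add set)
    \<Rightarrow> nat \<Rightarrow> int \<Rightarrow> ('k, ('b list \<Rightarrow> 'b) set) vspace" where
  "cohomology sc br H p l =
     vquotient (fun_scale sc)
       {\<omega>\<in>cochains_deg sc H p l. ce_diff sc br H \<omega> = 0}
       (if p = 0 then {0} else ce_diff sc br H ` cochains_deg sc H (p - 1) l)"

section \<open>The spaces S, Z and B\<close>

text \<open>\<open>ad_word [X\<^sub>1, \<dots>, X\<^sub>s]\<close> is \<open>ad\<^bsub>X\<^sub>1\<^esub> \<cdots> ad\<^bsub>X\<^sub>s\<^sub>-\<^sub>1\<^esub> (X\<^sub>s)\<close>.\<close>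

fun ad_word :: "('a \<Rightarrow> 'a \<Rightarrow> 'a) \<Rightarrow> 'a::zero list \<Rightarrow> 'a" where
  "ad_word bracket [] = 0"
| "ad_word bracket [x] = x"
| "ad_word bracket (x # y # ys) = bracket x (ad_word bracket (y # ys))"

text \<open>Both defining conditions say that an expression in \<open>X\<^sub>1, \<dots>, X\<^sub>s\<close> depends only on the element
  \<open>ad\<^bsub>X\<^sub>1\<^esub> \<cdots> ad\<^bsub>X\<^sub>s\<^sub>-\<^sub>1\<^esub> (X\<^sub>s)\<close> of \<open>g\<^sub>-\<^sub>s\<close>. As the elements of \<open>g\<^sub>-\<^sub>s\<close> are in general only finite
  sums of such monomials, the condition is imposed on finite sums: \<open>ws\<close> and \<open>ws'\<close> are finite
  families of words of length \<open>s\<close>, and one-element families give the condition on single monomials.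

  The condition on single monomials alone is too weak: let \<open>\<omega>\<close> be a bivector of rank 6 on a
  6-dimensional \<open>V\<close>, \<open>g\<^sub>-\<^sub>1 = V\<close>, \<open>g\<^sub>-\<^sub>2 = \<Lambda>\<^sup>2V/\<langle>\<omega>\<rangle>\<close>, and \<open>g\<^sub>0\<close> spanned by the grading element \<open>E\<close>.
  No nonzero multiple of \<open>\<omega>\<close> is a difference of two decomposable bivectors, so for \<open>l = 2\<close> that
  condition holds for every \<open>\<alpha>\<close>, whereas \<open>\<alpha>\<close> extends to a cocycle only if \<open>\<alpha>(X)(Y) - \<alpha>(Y)(X)\<close>
  vanishes on \<open>\<omega>\<close>.\<close>

definition words :: "(int \<Rightarrow> 'a set) \<Rightarrow> nat \<Rightarrow> 'a list set" where
  "words G s = {xs. length xs = s \<and> set xs \<subseteq> G (- 1)}"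

definition ad_words_eq ::
  "('a \<Rightarrow> 'a \<Rightarrow> 'a) \<Rightarrow> (int \<Rightarrow> 'a::ab_group_add set) \<Rightarrow> nat \<Rightarrow> 'a list list \<Rightarrow> 'a list list \<Rightarrow> bool" where
  "ad_words_eq bracket G s ws ws' \<longleftrightarrow>
     set ws \<subseteq> words G s \<and> set ws' \<subseteq> words G s \<and>
     (\<Sum>xs\<leftarrow>ws. ad_word bracket xs) = (\<Sum>xs\<leftarrow>ws'. ad_word bracket xs)"

definition S_expr :: "('a \<Rightarrow> 'a \<Rightarrow> 'a) \<Rightarrow> ('a \<Rightarrow> 'a) \<Rightarrow> 'a::ab_group_add list \<Rightarrow> 'a" where
  "S_expr bracket f xs = (\<Sum>i<length xs. ad_word bracket (xs[i := f (xs ! i)]))"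

definition S_space ::
  "('k::field \<Rightarrow> 'a \<Rightarrow> 'a) \<Rightarrow> ('a \<Rightarrow> 'a \<Rightarrow> 'a) \<Rightarrow> (int \<Rightarrow> 'a::ab_group_add set) \<Rightarrow> ('a \<Rightarrow> 'a) set" where
  "S_space scale bracket G =
     {f\<in>Hom scale scale (G (- 1)) (G 0).
        \<forall>s\<ge>1. \<forall>ws ws'. ad_words_eq bracket G s ws ws' \<longrightarrow>
          (\<Sum>xs\<leftarrow>ws. S_expr bracket f xs) = (\<Sum>xs\<leftarrow>ws'. S_expr bracket f xs)}"

definition ad_tail :: "('a \<Rightarrow> 'a \<Rightarrow> 'a) \<Rightarrow> 'a::zero list \<Rightarrow> 'a \<Rightarrow> 'a" where
  "ad_tail bracket ys z = (if ys = [] then z else bracket (ad_word bracket ys) z)"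

text \<open>List indices start at 0, hence the sign \<open>(-1)\<^sup>i\<close>; \<open>fold bracket [X\<^sub>1, \<dots>, X\<^sub>i\<^sub>-\<^sub>1] z\<close> is
  \<open>ad\<^bsub>X\<^sub>i\<^sub>-\<^sub>1\<^esub> \<cdots> ad\<^bsub>X\<^sub>1\<^esub> (z)\<close>.\<close>

definition Z_expr ::
  "('a \<Rightarrow> 'a \<Rightarrow> 'a) \<Rightarrow> ('a \<Rightarrow> 'a \<Rightarrow> 'k::field) \<Rightarrow> 'a::zero list \<Rightarrow> 'a \<Rightarrow> 'k" where
  "Z_expr bracket \<alpha> xs z =
     (\<Sum>i<length xs. (- 1) ^ i *
        \<alpha> (xs ! i) (ad_tail bracket (drop (Suc i) xs) (fold bracket (take i xs) z)))"

text \<open>For \<open>l = 1\<close> the range \<open>2 \<le> s \<le> l\<close> is empty and \<open>Z\<^sub>1 = Hom(g\<^sub>-\<^sub>1, (g\<^sub>0)\<^sup>*)\<close>.\<close>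

definition Z_space ::
  "('k::field \<Rightarrow> 'a \<Rightarrow> 'a) \<Rightarrow> ('a \<Rightarrow> 'a \<Rightarrow> 'a) \<Rightarrow> (int \<Rightarrow> 'a::ab_group_add set) \<Rightarrow> int
    \<Rightarrow> ('a \<Rightarrow> 'a \<Rightarrow> 'k) set" where
  "Z_space scale bracket G l =
     {\<alpha>\<in>Hom scale (fun_scale (*)) (G (- 1)) (dual_comp scale G (1 - l)).
        \<forall>s. 2 \<le> s \<and> int s \<le> l \<longrightarrow>
          (\<forall>ws ws'. ad_words_eq bracket G s ws ws' \<longrightarrow>
             (\<forall>z\<in>G (int s - l).
                (\<Sum>xs\<leftarrow>ws. Z_expr bracket \<alpha> xs z) = (\<Sum>xs\<leftarrow>ws'. Z_expr bracket \<alpha> xs z)))}"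

definition hat ::
  "('a \<Rightarrow> 'a \<Rightarrow> 'a) \<Rightarrow> (int \<Rightarrow> 'a set) \<Rightarrow> ('a \<Rightarrow> 'k::field) \<Rightarrow> 'a \<Rightarrow> 'a \<Rightarrow> 'k" where
  "hat bracket G \<beta> x = (if x \<in> G (- 1) then (\<lambda>z. - \<beta> (bracket x z)) else 0)"

definition B_space ::
  "('k::field \<Rightarrow> 'a \<Rightarrow> 'a) \<Rightarrow> ('a \<Rightarrow> 'a \<Rightarrow> 'a) \<Rightarrow> (int \<Rightarrow> 'a::ab_group_add set) \<Rightarrow> int
    \<Rightarrow> ('a \<Rightarrow> 'a \<Rightarrow> 'k) set" where
  "B_space scale bracket G l = hat bracket G ` dual_comp scale G (- l)"

end

theory Submission
  imports Defs
begin

text \<open>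
  As a vector space \<open>h = g \<oplus> g\<^sup>*\<close>, and \<open>[X, Y + \<eta>] = [X, Y] + L\<^sub>X(\<eta>)\<close> for \<open>X\<close> in \<open>g\<close>. So \<open>h\<close> is, as a module
  over \<open>h\<^sub>- = g\<^sub>-\<close>, the sum of the adjoint and the coadjoint module, and a 1-cochain \<open>D\<close> is a cocycle
  iff \<open>D [X, Y] = X \<cdot> D Y - Y \<cdot> D X\<close>. Also \<open>h\<^sub>i = g\<^sub>i \<oplus> (g\<^sub>-\<^sub>i)\<^sup>*\<close> for every \<open>i\<close>, because the first summand
  vanishes for \<open>i > 0\<close> and the second for \<open>i < 0\<close>.

  The main step concerns any graded \<open>g\<close>-module \<open>M\<close> in the place of \<open>h\<close>. As \<open>g\<^sub>-\<^sub>1\<close> generates \<open>g\<^sub>-\<close>, a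
  cocycle \<open>D\<close> of degree \<open>l\<close> is determined by \<open>\<alpha> = D|g\<^sub>-\<^sub>1\<close>: the cocycle identity forces its value on
  \<open>ad\<^bsub>X\<^sub>1\<^esub> \<cdots> ad\<^bsub>X\<^sub>s\<^sub>-\<^sub>1\<^esub> (X\<^sub>s)\<close> to be an expression \<open>E(X\<^sub>1, \<dots>, X\<^sub>s)\<close> in \<open>\<alpha>\<close>. Conversely \<open>\<alpha>\<close> extends to a
  cocycle as soon as sums of the values \<open>E\<close> depend only on the corresponding sums of words
  (\<open>bij_betw_generator_part\<close>). The reason is that a linear map \<open>D\<close> is a cocycle iff its graph is a
  subalgebra of the semidirect product of \<open>g\<^sub>-\<close> and the abelian ideal \<open>M\<close>. The graph of the extension
  has to be the subalgebra generated by the pairs \<open>(X, \<alpha> X)\<close>, which the Jacobi identity shows to be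
  spanned by the words in these pairs (\<open>graph_semidirect\<close>); such a word is
  \<open>(ad\<^bsub>X\<^sub>1\<^esub> \<cdots> ad\<^bsub>X\<^sub>s\<^sub>-\<^sub>1\<^esub> (X\<^sub>s), E(X\<^sub>1, \<dots>, X\<^sub>s))\<close>, and the condition on \<open>\<alpha>\<close> says that this subalgebra is the
  graph of a map.

  For \<open>M = h\<close> and \<open>\<alpha> = f + \<phi>\<close> with \<open>f\<close> valued in \<open>g\<^sub>l\<^sub>-\<^sub>1\<close> and \<open>\<phi>\<close> in \<open>(g\<^sub>1\<^sub>-\<^sub>l)\<^sup>*\<close>, the two components of \<open>E\<close>
  are the expressions that define \<open>S(g)\<close> and \<open>Z\<^sub>l(g)\<close> (\<open>word_value_cot\<close>). For \<open>l \<ge> 2\<close> the space \<open>g\<^sub>l\<^sub>-\<^sub>1\<close>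
  is zero, so that \<open>f = 0\<close>; for \<open>l = 1\<close> the map \<open>f\<close> ranges over \<open>S(g)\<close>. The second component of \<open>E\<close> on
  words of length \<open>s\<close> lies in \<open>(g\<^sub>s\<^sub>-\<^sub>l)\<^sup>*\<close>, which is zero for \<open>s > l\<close>, and for \<open>s = 1\<close> the condition is
  the additivity of \<open>\<phi>\<close>; this leaves the range \<open>2 \<le> s \<le> l\<close> of the definition of \<open>Z\<^sub>l(g)\<close>
  (\<open>Z_space_iff\<close>, \<open>extendable_iff\<close>).

  Finally \<open>C\<^sup>0\<^sub>l = h\<^sub>l = (g\<^sub>-\<^sub>l)\<^sup>*\<close> for \<open>l \<ge> 1\<close>, and the coboundary of \<open>\<beta>\<close> restricts to \<open>0\<close> plus the map with
  \<open>X \<mapsto> L\<^sub>X(\<beta>)\<close>, i.e. the elements of \<open>B\<^sub>l(g)\<close> (\<open>coboundaries_h_iff\<close>). The isomorphisms are then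
  induced by restriction of cocycles to \<open>g\<^sub>-\<^sub>1\<close>.
\<close>

section \<open>Quotients of vector spaces\<close>

lemma coset_eq_iff:
  assumes "vector_space sc" "module.subspace sc W"
  shows "v +o W = v' +o W \<longleftrightarrow> v - v' \<in> W"
proof -
  interpret vector_space sc by fact
  note [simp] = subspace_add[OF assms(2)] subspace_diff[OF assms(2)] subspace_0[OF assms(2)]
  show ?thesis
  proof
    assume "v +o W = v' +o W"
    then have "v + 0 \<in> v' +o W" using set_plus_intro2[of 0 W v] by simp
    then show "v - v' \<in> W" by (auto simp: elt_set_plus_def)
  next
    assume d: "v - v' \<in> W"
    have "v + w \<in> v' +o W" "v' + w \<in> v +o W" if "w \<in> W" for w
    proof -
      have "v + w = v' + (v - v' + w)" "v' + w = v + (w - (v - v'))"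
        by (simp_all add: algebra_simps)
      then show "v + w \<in> v' +o W" "v' + w \<in> v +o W"
        using d that by (metis set_plus_intro2 subspace_add subspace_diff assms(2))+
    qed
    then show "v +o W = v' +o W" by (auto simp: elt_set_plus_def)
  qed
qed

lemma coset_add:
  assumes "vector_space sc" "module.subspace sc W"
  shows "(v +o W) + (v' +o W) = (v + v') +o W"
proof -
  interpret vector_space sc by fact
  have "v + v' + w = (v + w) + (v' + 0)" "(v + w) + (v' + w') = v + v' + (w + w')" for w w'
    by (simp_all add: algebra_simps)
  then show ?thesis
    using subspace_add[OF assms(2)] subspace_0[OF assms(2)]
    by (fastforce simp: elt_set_plus_def set_plus_def)
qed

lemma coset_scale:
  assumes "vector_space sc" "module.subspace sc W"
  shows "sc c ` (v +o W) + W = sc c v +o W"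
proof -
  interpret vector_space sc by fact
  have "sc c v + w = sc c (v + 0) + w" "sc c (v + w) + w' = sc c v + (sc c w + w')" for w w'
    by (simp_all add: scale_right_distrib algebra_simps)
  then show ?thesis
    using subspace_add[OF assms(2)] subspace_0[OF assms(2)] subspace_scale[OF assms(2)]
    by (fastforce simp: elt_set_plus_def set_plus_def)
qed

text \<open>The first isomorphism theorem, with the kernel of \<open>\<Phi>\<close> expressed by differences, as the target \<open>F\<close>
  is a structure and has no zero element to refer to.\<close>

lemma vquotient_iso:
  assumes vs: "vector_space sc" and V: "module.subspace sc V"
    and W: "module.subspace sc W" "W \<subseteq> V"
    and surj: "\<Phi> ` V = vcarrier F"
    and add: "\<And>v w. v \<in> V \<Longrightarrow> w \<in> V \<Longrightarrow> \<Phi> (v + w) = vadd F (\<Phi> v) (\<Phi> w)"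
    and smult: "\<And>c v. v \<in> V \<Longrightarrow> \<Phi> (sc c v) = vsmult F c (\<Phi> v)"
    and ker: "\<And>v w. v \<in> V \<Longrightarrow> w \<in> V \<Longrightarrow> \<Phi> v = \<Phi> w \<longleftrightarrow> v - w \<in> W"
  shows "vs_iso (vquotient sc V W) F"
proof -
  interpret vector_space sc by fact
  define T where "T A = the_elem (\<Phi> ` A)" for A
  have T: "T (v +o W) = \<Phi> v" if v: "v \<in> V" for v
  proof -
    have "\<Phi> (v + w) = \<Phi> v" if "w \<in> W" for w
      using ker[of "v + w" v] subspace_add[OF V] v that W(2) by auto
    then have "\<Phi> ` (v +o W) = {\<Phi> v}"
      using subspace_0[OF W(1)] by (fastforce simp: elt_set_plus_def image_iff)
    then show ?thesis by (simp add: T_def)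
  qed
  have "bij_betw T ((\<lambda>v. v +o W) ` V) (vcarrier F)"
    unfolding bij_betw_def inj_on_def
    using surj by (auto simp: T ker coset_eq_iff[OF vs W(1)] image_image cong: image_cong_simp)
  then show ?thesis
    unfolding vs_iso_def vquotient_def
    by (intro exI[of _ T])
      (auto simp: coset_add[OF vs W(1)] coset_scale[OF vs W(1)] T add smult
        subspace_add[OF V] subspace_scale[OF V])
qed

lemma vector_space_fun_scale:
  assumes "vector_space sc"
  shows "vector_space (fun_scale sc)"
proof -
  interpret vector_space sc by fact
  show ?thesis
    by unfold_locales (auto simp: fun_scale_def fun_eq_iff scale_right_distrib scale_left_distrib)
qed

lemma subspace_Hom:
  assumes "vector_space s2" "module.subspace s2 V"
  shows "module.subspace (fun_scale s2) (Hom s1 s2 U V)"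
proof -
  interpret B: vector_space s2 by fact
  interpret F: vector_space "fun_scale s2" by (rule vector_space_fun_scale) fact
  show ?thesis
    unfolding F.subspace_def Hom_def
    using B.subspace_add[OF assms(2)] B.subspace_0[OF assms(2)] B.subspace_scale[OF assms(2)]
    by (auto simp: fun_scale_def B.scale_right_distrib algebra_simps)
qed

section \<open>Gradations\<close>

context fundamental_lie_algebra
begin

abbreviation N :: "'a set" where
  "N \<equiv> negative_part scale G"

lemma bracket_add_left: "bracket (x + y) z = bracket x z + bracket y z"
  and bracket_scale_left: "bracket (scale c x) z = scale c (bracket x z)"
  and bracket_add_right: "bracket z (x + y) = bracket z x + bracket z y"
  and bracket_scale_right: "bracket z (scale c x) = scale c (bracket z x)"
  using linear_left[of z] linear_right[of z]
  by (simp_all add: Vector_Spaces.linear_iff)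

lemma bracket_0_left [simp]: "bracket 0 z = 0"
  and bracket_0_right [simp]: "bracket z 0 = 0"
  using bracket_add_left[of 0 0 z] bracket_add_right[of z 0 0] by simp_all

lemma bracket_minus_right: "bracket z (- x) = - bracket z x"
  using bracket_add_right[of z x "- x"] by (simp add: eq_neg_iff_add_eq_0 add.commute)

lemma bracket_antisym: "bracket y x = - bracket x y"
  using alternating[of "x + y"] alternating[of x] alternating[of y]
  by (simp add: bracket_add_left bracket_add_right eq_neg_iff_add_eq_0 add.commute)

lemma bracket_bracket:
  "bracket (bracket x y) z = bracket x (bracket y z) - bracket y (bracket x z)"
proof -
  have "bracket x (bracket y z) + bracket y (bracket z x) = - bracket z (bracket x y)"
    using jacobi[of x y z] by (simp only: eq_neg_iff_add_eq_0)
  then show ?thesis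
    using bracket_antisym[of "bracket x y" z] bracket_antisym[of x z]
    by (simp add: bracket_minus_right)
qed

lemma subspace_N: "subspace N"
  by (simp add: negative_part_def subspace_span)

lemma G_in_N: "i < 0 \<Longrightarrow> x \<in> G i \<Longrightarrow> x \<in> N"
  unfolding negative_part_def by (rule span_base) auto

lemma N_subset:
  assumes "subspace T" "\<And>i x. i < 0 \<Longrightarrow> x \<in> G i \<Longrightarrow> x \<in> T"
  shows "N \<subseteq> T"
  unfolding negative_part_def using assms by (intro span_minimal) auto

lemma bracket_N:
  assumes "x \<in> N" "y \<in> N"
  shows "bracket x y \<in> N"
proof -
  have "y \<in> {y. bracket x y \<in> N}" if x: "x \<in> G i" and i: "i < 0" for x i
  proof (rule subsetD[OF N_subset assms(2)])
    show "subspace {y. bracket x y \<in> N}"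
      using subspace_N by (auto simp: subspace_def bracket_add_right bracket_scale_right)
    show "y \<in> {y. bracket x y \<in> N}" if "j < 0" "y \<in> G j" for j y
      using bracket_G[OF x that(2)] G_in_N[of "i + j"] i that(1) by simp
  qed
  then have "x \<in> {x. bracket x y \<in> N}"
    using subspace_N assms(1)
    by (intro subsetD[OF N_subset assms(1)])
      (auto simp: subspace_def bracket_add_left bracket_scale_left)
  then show ?thesis by simp
qed

definition component :: "'a \<Rightarrow> int \<Rightarrow> 'a" where
  "component x = (THE c. (\<forall>i. c i \<in> G i) \<and> x = (\<Sum>i\<in>{- k..0}. c i))"

lemma component_G: "component x i \<in> G i"
  and sum_component: "(\<Sum>i\<in>{- k..0}. component x i) = x"
  using theI'[OF direct_sum[of x], folded component_def] by auto

lemma component_unique: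
  assumes "\<And>i. c i \<in> G i" "x = (\<Sum>i\<in>{- k..0}. c i)"
  shows "component x = c"
  using assms direct_sum[of x] component_G[of x] sum_component[of x] by (metis (lifting))

lemma component_add: "component (x + y) i = component x i + component y i"
proof -
  have "component (x + y) = (\<lambda>i. component x i + component y i)"
    by (rule component_unique) (auto simp: sum.distrib sum_component intro: subspace_add subspace_G component_G)
  then show ?thesis by simp
qed

lemma component_scale: "component (scale c x) i = scale c (component x i)"
proof -
  have "component (scale c x) = (\<lambda>i. scale c (component x i))"
    by (rule component_unique)
      (auto simp: sum_component simp flip: scale_sum_right intro: subspace_scale subspace_G component_G)
  then show ?thesis by simp
qed

lemma component_homogeneous:
  assumes "x \<in> G i"
  shows "component x j = (if j = i then x else 0)"
proof (cases "i \<in> {- k..0}")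
  case True
  have "component x = (\<lambda>j. if j = i then x else 0)"
    using assms True by (intro component_unique) (auto simp: subspace_0[OF subspace_G])
  then show ?thesis by simp
next
  case False
  then have "x = 0" using assms G_outside[of i] by auto
  moreover have "component 0 j = 0" using component_scale[of 0 0 j] by simp
  ultimately show ?thesis by simp
qed

lemma wordsD:
  assumes "xs \<in> words G s" "s \<ge> 1"
  shows "xs \<noteq> []" "set xs \<subseteq> G (- 1)" "length xs = s"
  using assms by (auto simp: words_def)

lemma ad_word_G:
  assumes "xs \<in> words G s" "s \<ge> 1"
  shows "ad_word bracket xs \<in> G (- int s)"
proof -
  have "ad_word bracket xs \<in> G (- int (length xs))" if "xs \<noteq> []" "set xs \<subseteq> G (- 1)"
    using that
  proof (induction xs rule: induct_list012)
    case (3 x y ys)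
    have e: "- int (length (x # y # ys)) = - 1 + - int (length (y # ys))" by simp
    show ?case unfolding e ad_word.simps using 3 by (intro bracket_G) auto
  qed auto
  then show ?thesis using wordsD[OF assms] by blast
qed

end

section \<open>Cocycles with values in a graded module\<close>

text \<open>A graded \<open>g\<close>-module. It is a subspace \<open>M\<close> of a type and not a whole type, so that linear
  functionals inside a type of functions are an instance.\<close>

locale graded_coefficients = fundamental_lie_algebra scale bracket k G + M: vector_space smul
  for scale :: "'k::field \<Rightarrow> 'a::ab_group_add \<Rightarrow> 'a" and bracket k G
    and smul :: "'k \<Rightarrow> 'm::ab_group_add \<Rightarrow> 'm" +
  fixes act :: "'a \<Rightarrow> 'm \<Rightarrow> 'm" and M :: "'m set" and Mg :: "int \<Rightarrow> 'm set"
  assumes subspace_M: "M.subspace M"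
    and subspace_Mg: "M.subspace (Mg j)"
    and Mg_M: "m \<in> Mg j \<Longrightarrow> m \<in> M"
    and act_M: "m \<in> M \<Longrightarrow> act x m \<in> M"
    and act_Mg: "x \<in> G i \<Longrightarrow> m \<in> Mg j \<Longrightarrow> act x m \<in> Mg (i + j)"
    and act_add_left: "m \<in> M \<Longrightarrow> act (x + y) m = act x m + act y m"
    and act_scale_left: "m \<in> M \<Longrightarrow> act (scale c x) m = smul c (act x m)"
    and act_add_right: "m \<in> M \<Longrightarrow> n \<in> M \<Longrightarrow> act x (m + n) = act x m + act x n"
    and act_scale_right: "m \<in> M \<Longrightarrow> act x (smul c m) = smul c (act x m)"
    and act_bracket: "m \<in> M \<Longrightarrow> act (bracket x y) m = act x (act y m) - act y (act x m)"
begin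

definition cocycles :: "int \<Rightarrow> ('a \<Rightarrow> 'm) set" where
  "cocycles l = {D \<in> Hom scale smul N M.
     (\<forall>i<0. \<forall>x\<in>G i. D x \<in> Mg (i + l)) \<and>
     (\<forall>x\<in>N. \<forall>y\<in>N. D (bracket x y) = act x (D y) - act y (D x))}"

text \<open>The value which the cocycle identity forces on \<open>ad_word bracket xs\<close> when \<open>\<alpha>\<close> is given on the
  generators.\<close>

fun word_value :: "('a \<Rightarrow> 'm) \<Rightarrow> 'a list \<Rightarrow> 'm" where
  "word_value \<alpha> [] = 0"
| "word_value \<alpha> [x] = \<alpha> x"
| "word_value \<alpha> (x # y # ys) =
     act x (word_value \<alpha> (y # ys)) - act (ad_word bracket (y # ys)) (\<alpha> x)"

definition extendable :: "int \<Rightarrow> ('a \<Rightarrow> 'm) set" where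
  "extendable l = {\<alpha> \<in> Hom scale smul (G (- 1)) (Mg (l - 1)).
     \<forall>s\<ge>1. \<forall>ws ws'. ad_words_eq bracket G s ws ws' \<longrightarrow>
       (\<Sum>xs\<leftarrow>ws. word_value \<alpha> xs) = (\<Sum>xs\<leftarrow>ws'. word_value \<alpha> xs)}"

definition generator_part :: "('a \<Rightarrow> 'm) \<Rightarrow> 'a \<Rightarrow> 'm" where
  "generator_part D x = (if x \<in> G (- 1) then D x else 0)"

lemma act_0_left [simp]: "m \<in> M \<Longrightarrow> act 0 m = 0"
  using act_add_left[of m 0 0] by simp

lemma act_0_right [simp]: "act x 0 = 0"
  using act_add_right[of 0 0 x] M.subspace_0[OF subspace_M] by simp

lemma act_minus_right: "m \<in> M \<Longrightarrow> act x (- m) = - act x m"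
  using act_scale_right[of m x "- 1"] by simp

lemma act_diff_right: "m \<in> M \<Longrightarrow> n \<in> M \<Longrightarrow> act x (m - n) = act x m - act x n"
  using act_add_right[of m "- n" x] M.subspace_neg[OF subspace_M] by (simp add: act_minus_right)

lemma word_value_cong:
  "(\<And>x. x \<in> set xs \<Longrightarrow> \<alpha> x = \<beta> x) \<Longrightarrow> word_value \<alpha> xs = word_value \<beta> xs"
  by (induction \<alpha> xs rule: word_value.induct) auto

lemma word_value_cocycle:
  assumes D: "D \<in> cocycles l" and xs: "xs \<in> words G s" "s \<ge> 1"
  shows "D (ad_word bracket xs) = word_value D xs"
proof -
  have "D (ad_word bracket xs) = word_value D xs" if "xs \<noteq> []" "set xs \<subseteq> G (- 1)" for xs
    using that
  proof (induction xs rule: induct_list012)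
    case (3 x y ys)
    have "x \<in> N" using 3 G_in_N[of "- 1" x] by auto
    moreover have "ad_word bracket (y # ys) \<in> N"
      using ad_word_G[of "y # ys" "length (y # ys)"] 3
      by (intro G_in_N[of "- int (length (y # ys))"]) (auto simp: words_def)
    ultimately show ?case using D 3 by (auto simp: cocycles_def)
  qed auto
  then show ?thesis using wordsD[OF xs] by blast
qed

text \<open>The bracket of the semidirect product of \<open>g\<close> with the abelian ideal \<open>M\<close>. A linear map is a
  cocycle iff its graph is closed under this bracket.\<close>

definition semidirect :: "'a \<times> 'm \<Rightarrow> 'a \<times> 'm \<Rightarrow> 'a \<times> 'm" where
  "semidirect p q = (bracket (fst p) (fst q), act (fst p) (snd q) - act (fst q) (snd p))"

lemma semidirect_add_left:
  "snd p \<in> M \<Longrightarrow> snd q \<in> M \<Longrightarrow> snd r \<in> M \<Longrightarrow>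
    semidirect (p + q) r = semidirect p r + semidirect q r"
  by (simp add: semidirect_def bracket_add_left act_add_left act_add_right prod_eq_iff)

lemma semidirect_add_right:
  "snd p \<in> M \<Longrightarrow> snd q \<in> M \<Longrightarrow> snd r \<in> M \<Longrightarrow>
    semidirect r (p + q) = semidirect r p + semidirect r q"
  by (simp add: semidirect_def bracket_add_right act_add_left act_add_right prod_eq_iff)

text \<open>This is the Jacobi identity of the semidirect product. It is where the module axiom for
  \<open>act (bracket x y)\<close> enters.\<close>

lemma semidirect_semidirect:
  assumes "snd p \<in> M" "snd q \<in> M" "snd r \<in> M"
  shows "semidirect (semidirect p q) r =
    semidirect p (semidirect q r) - semidirect q (semidirect p r)"
  using assms
  by (simp add: semidirect_def bracket_bracket act_bracket act_diff_right act_M prod_eq_iff)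

definition word_pair :: "('a \<Rightarrow> 'm) \<Rightarrow> 'a list \<Rightarrow> 'a \<times> 'm" where
  "word_pair \<alpha> xs = (ad_word bracket xs, word_value \<alpha> xs)"

text \<open>The part of degree \<open>-s\<close> of the subalgebra of the semidirect product generated by the pairs
  \<open>(x, \<alpha> x)\<close> with \<open>x\<close> in \<open>G (- 1)\<close>: \<open>word_pair \<alpha> xs\<close> is the word \<open>xs\<close> formed from these pairs. If
  \<open>\<alpha>\<close> extends to a cocycle, this is the graph of the extension over \<open>G (- s)\<close>.\<close>

definition graph :: "('a \<Rightarrow> 'm) \<Rightarrow> nat \<Rightarrow> ('a \<times> 'm) set" where
  "graph \<alpha> s = {\<Sum>xs\<leftarrow>ws. word_pair \<alpha> xs | ws. set ws \<subseteq> words G s}"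

lemma fst_sum_word_pair: "fst (\<Sum>xs\<leftarrow>ws. word_pair \<alpha> xs) = (\<Sum>xs\<leftarrow>ws. ad_word bracket xs)"
  and snd_sum_word_pair: "snd (\<Sum>xs\<leftarrow>ws. word_pair \<alpha> xs) = (\<Sum>xs\<leftarrow>ws. word_value \<alpha> xs)"
  by (induction ws) (simp_all add: word_pair_def)

lemma graph_add: "p \<in> graph \<alpha> s \<Longrightarrow> q \<in> graph \<alpha> s \<Longrightarrow> p + q \<in> graph \<alpha> s"
proof -
  assume "p \<in> graph \<alpha> s" "q \<in> graph \<alpha> s"
  then obtain ws ws' where "set ws \<subseteq> words G s" "set ws' \<subseteq> words G s"
    "p = (\<Sum>xs\<leftarrow>ws. word_pair \<alpha> xs)" "q = (\<Sum>xs\<leftarrow>ws'. word_pair \<alpha> xs)"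
    by (auto simp: graph_def)
  then show ?thesis unfolding graph_def by (auto intro!: exI[of _ "ws @ ws'"])
qed

lemma graph_0: "0 \<in> graph \<alpha> s"
  unfolding graph_def by (auto intro!: exI[of _ "[]"])

lemma graph_induct [consumes 1, case_names zero add]:
  assumes "p \<in> graph \<alpha> s" "P 0"
    and "\<And>xs q. xs \<in> words G s \<Longrightarrow> q \<in> graph \<alpha> s \<Longrightarrow> P q \<Longrightarrow> P (word_pair \<alpha> xs + q)"
  shows "P p"
proof -
  obtain ws where "set ws \<subseteq> words G s" "p = (\<Sum>xs\<leftarrow>ws. word_pair \<alpha> xs)"
    using assms(1) by (auto simp: graph_def)
  then show ?thesis
  proof (induction ws arbitrary: p)
    case (Cons xs ws)
    then show ?case using assms(3)[of xs "\<Sum>xs\<leftarrow>ws. word_pair \<alpha> xs"]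
      by (auto simp: graph_def)
  qed (simp add: assms(2))
qed

lemma word_pair_graph: "xs \<in> words G s \<Longrightarrow> word_pair \<alpha> xs \<in> graph \<alpha> s"
  unfolding graph_def by (auto intro!: exI[of _ "[xs]"])

context
  fixes \<alpha> l
  assumes \<alpha>: "\<alpha> \<in> Hom scale smul (G (- 1)) (Mg (l - 1))"
begin

lemma \<alpha>_Mg: "x \<in> G (- 1) \<Longrightarrow> \<alpha> x \<in> Mg (l - 1)"
  and \<alpha>_M: "x \<in> G (- 1) \<Longrightarrow> \<alpha> x \<in> M"
  using \<alpha> by (auto simp: Hom_def intro: Mg_M)

lemma word_value_Mg:
  assumes "xs \<in> words G s" "s \<ge> 1"
  shows "word_value \<alpha> xs \<in> Mg (l - int s)"
proof -
  have "word_value \<alpha> xs \<in> Mg (l - int (length xs))" if "xs \<noteq> []" "set xs \<subseteq> G (- 1)" for xs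
    using that
  proof (induction xs rule: induct_list012)
    case (3 x y ys)
    let ?w = "ad_word bracket (y # ys)"
    have e: "l - int (length (x # y # ys)) = - 1 + (l - int (length (y # ys)))"
      "l - int (length (x # y # ys)) = - int (length (y # ys)) + (l - 1)" by simp_all
    have "act x (word_value \<alpha> (y # ys)) \<in> Mg (l - int (length (x # y # ys)))"
      unfolding e(1) using 3 by (intro act_Mg) auto
    moreover have "?w \<in> G (- int (length (y # ys)))"
      using 3 by (intro ad_word_G) (auto simp: words_def)
    then have "act ?w (\<alpha> x) \<in> Mg (l - int (length (x # y # ys)))"
      unfolding e(2) using 3 by (intro act_Mg \<alpha>_Mg) auto
    ultimately show ?case by (simp add: M.subspace_diff[OF subspace_Mg])
  qed (simp_all add: \<alpha>_Mg)
  then show ?thesis using wordsD[OF assms] by blast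
qed

lemma graph_homogeneous:
  assumes "p \<in> graph \<alpha> s" "s \<ge> 1"
  shows "fst p \<in> G (- int s)" "snd p \<in> Mg (l - int s)" "snd p \<in> M"
proof -
  show "fst p \<in> G (- int s)"
    using assms(1) by (induction rule: graph_induct)
      (auto simp: word_pair_def subspace_0[OF subspace_G] ad_word_G[OF _ assms(2)]
        intro!: subspace_add[OF subspace_G])
  show "snd p \<in> Mg (l - int s)"
    using assms(1) by (induction rule: graph_induct)
      (auto simp: word_pair_def M.subspace_0[OF subspace_Mg] word_value_Mg[OF _ assms(2)]
        intro!: M.subspace_add[OF subspace_Mg])
  then show "snd p \<in> M" by (rule Mg_M)
qed

text \<open>Words are linear in their first letter, so a scalar can be absorbed there and sums of words
  are already all linear combinations.\<close>

lemma graph_scale: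
  assumes "p \<in> graph \<alpha> s" "s \<ge> 1"
  shows "(scale c (fst p), smul c (snd p)) \<in> graph \<alpha> s"
  using assms(1)
proof (induction rule: graph_induct)
  case zero
  then show ?case using graph_0 by (simp add: zero_prod_def)
next
  case (add xs q)
  obtain x ys where xs: "xs = x # ys" using add(1) assms(2) by (cases xs) (auto simp: words_def)
  have set: "set xs \<subseteq> G (- 1)" using add(1) by (simp add: words_def)
  let ?xs = "scale c x # ys"
  have "?xs \<in> words G s"
    using add(1) by (auto simp: xs words_def intro: subspace_scale[OF subspace_G])
  then have w: "word_pair \<alpha> ?xs \<in> graph \<alpha> s" by (rule word_pair_graph)
  have \<alpha>x: "\<alpha> (scale c x) = smul c (\<alpha> x)" using \<alpha> set xs by (auto simp: Hom_def)
  have "word_pair \<alpha> ?xs = (scale c (ad_word bracket xs), smul c (word_value \<alpha> xs))"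
  proof (cases ys)
    case Nil
    then show ?thesis by (simp add: xs word_pair_def \<alpha>x)
  next
    case (Cons y zs)
    have "word_value \<alpha> ys \<in> M"
      using set word_value_Mg[of ys "length ys"] by (auto simp: xs words_def Cons intro: Mg_M)
    then show ?thesis
      using set \<alpha>_M[of x]
      by (simp add: xs word_pair_def \<alpha>x Cons bracket_scale_left act_scale_left act_scale_right
          M.scale_right_diff_distrib)
  qed
  then have "(scale c (fst (word_pair \<alpha> xs + q)), smul c (snd (word_pair \<alpha> xs + q)))
    = word_pair \<alpha> ?xs + (scale c (fst q), smul c (snd q))"
    by (simp add: word_pair_def scale_right_distrib M.scale_right_distrib)
  then show ?case using graph_add[OF w add(3)] by simp
qed

lemma graph_diff:
  assumes "p \<in> graph \<alpha> s" "q \<in> graph \<alpha> s" "s \<ge> 1"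
  shows "p - q \<in> graph \<alpha> s"
proof -
  have "p - q = p + (scale (- 1) (fst q), smul (- 1) (snd q))" by (simp add: prod_eq_iff)
  then show ?thesis using graph_add[OF assms(1) graph_scale[OF assms(2,3), of "- 1"]] by metis
qed

lemma graph_letter:
  assumes x: "x \<in> G (- 1)" and p: "p \<in> graph \<alpha> s" and s: "s \<ge> 1"
  shows "semidirect (x, \<alpha> x) p \<in> graph \<alpha> (Suc s)"
  using p
proof (induction rule: graph_induct)
  case zero
  then show ?case using x graph_0 \<alpha>_M[of x] by (simp add: semidirect_def zero_prod_def)
next
  case (add xs q)
  have ne: "xs \<noteq> []" using add(1) s by (auto simp: words_def)
  have "word_pair \<alpha> (x # xs) \<in> graph \<alpha> (Suc s)"
    using x add(1) by (intro word_pair_graph) (auto simp: words_def)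
  moreover have "semidirect (x, \<alpha> x) (word_pair \<alpha> xs) = word_pair \<alpha> (x # xs)"
    using ne by (cases xs) (auto simp: semidirect_def word_pair_def)
  ultimately show ?case
    using add x s graph_homogeneous(3)[OF word_pair_graph[OF add(1)] s] graph_homogeneous(3)[of q s]
    by (simp add: semidirect_add_right \<alpha>_M graph_add)
qed

text \<open>The bracket of a word \<open>[X, W]\<close> with \<open>Q\<close> is \<open>[X, [W, Q]] - [W, [X, Q]]\<close>: this reduces the bracket
  with a word of length \<open>s\<close> to brackets with single letters and with the word \<open>W\<close> of length \<open>s - 1\<close>, at
  the cost of a larger degree of the other factor.\<close>

lemma graph_semidirect_word:
  assumes "xs \<noteq> []" "set xs \<subseteq> G (- 1)" "q \<in> graph \<alpha> t" "t \<ge> 1"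
  shows "semidirect (word_pair \<alpha> xs) q \<in> graph \<alpha> (length xs + t)"
  using assms
proof (induction xs arbitrary: q t rule: induct_list012)
  case (2 x)
  then show ?case using graph_letter[of x q t] by (simp add: word_pair_def)
next
  case (3 x y ys)
  let ?w = "word_pair \<alpha> (y # ys)"
  have w: "?w \<in> graph \<alpha> (length (y # ys))"
    using 3 by (intro word_pair_graph) (auto simp: words_def)
  have x: "x \<in> G (- 1)" using 3 by simp
  have split: "word_pair \<alpha> (x # y # ys) = semidirect (x, \<alpha> x) ?w"
    by (simp add: word_pair_def semidirect_def)
  have M: "snd ?w \<in> M" "snd q \<in> M"
    using graph_homogeneous(3)[OF w] graph_homogeneous(3)[of q t] 3 by auto
  have "semidirect (x, \<alpha> x) (semidirect ?w q) \<in> graph \<alpha> (length (x # y # ys) + t)"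
    using graph_letter[OF x "3.IH"(2)[of q t]] 3 by simp
  moreover have "semidirect ?w (semidirect (x, \<alpha> x) q) \<in> graph \<alpha> (length (x # y # ys) + t)"
    using "3.IH"(2)[OF _ _ graph_letter[OF x 3(5)]] 3 by simp
  ultimately show ?case
    using x M by (simp add: split semidirect_semidirect \<alpha>_M graph_diff)
qed simp

lemma graph_semidirect:
  assumes "p \<in> graph \<alpha> s" "q \<in> graph \<alpha> t" "s \<ge> 1" "t \<ge> 1"
  shows "semidirect p q \<in> graph \<alpha> (s + t)"
  using assms(1)
proof (induction rule: graph_induct)
  case zero
  then show ?case
    using graph_0 graph_homogeneous(3)[OF assms(2,4)] by (simp add: semidirect_def zero_prod_def)
next
  case (add xs r)
  have "xs \<noteq> []" using add(1) assms(3) by (auto simp: words_def)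
  then have "semidirect (word_pair \<alpha> xs) q \<in> graph \<alpha> (s + t)"
    using graph_semidirect_word[OF _ _ assms(2,4), of xs] add(1) by (auto simp: words_def)
  then show ?case
    using add graph_homogeneous(3)[OF word_pair_graph[OF add(1)] assms(3)] assms
      graph_homogeneous(3)[of r s] graph_homogeneous(3)[of q t]
    by (simp add: semidirect_add_left graph_add)
qed

text \<open>The first components of the word pairs span a subalgebra that contains \<open>G (- 1)\<close>, hence all of
  the negative part, as \<open>G (- 1)\<close> generates it. Taking components of degree \<open>-s\<close> shows that words of
  length \<open>s\<close> suffice for \<open>G (- s)\<close>.\<close>

lemma graph_total:
  assumes "x \<in> G (- int s)" "s \<ge> 1"
  shows "\<exists>m. (x, m) \<in> graph \<alpha> s"
proof -
  define L where "L = span (\<Union>s\<in>{1..}. fst ` graph \<alpha> s)"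
  have L: "subspace L" unfolding L_def by simp
  have base: "fst p \<in> L" if "p \<in> graph \<alpha> s" "s \<ge> 1" for p s
    unfolding L_def using that by (intro span_base) auto
  have L_bracket: "bracket x y \<in> L" if x: "x \<in> L" and y: "y \<in> L" for x y
  proof -
    have "L \<subseteq> {y. bracket (fst p) y \<in> L}" if p: "p \<in> graph \<alpha> s" "s \<ge> 1" for p s
      unfolding L_def
    proof (rule span_minimal, fold L_def)
      show "subspace {y. bracket (fst p) y \<in> L}"
        using L by (auto simp: subspace_def bracket_add_right bracket_scale_right)
      show "(\<Union>s\<in>{1..}. fst ` graph \<alpha> s) \<subseteq> {y. bracket (fst p) y \<in> L}"
        using base[OF graph_semidirect[OF p(1) _ p(2)]] p(2)
        by (auto simp: semidirect_def)
    qed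
    then have "L \<subseteq> {x. bracket x y \<in> L}"
      using L y by (subst L_def, intro span_minimal)
        (auto simp: subspace_def bracket_add_left bracket_scale_left)
    then show ?thesis using x by auto
  qed
  have "fst (word_pair \<alpha> [x]) \<in> L" if "x \<in> G (- 1)" for x
    using that by (intro base[of _ 1] word_pair_graph) (auto simp: words_def)
  then have "lie_subalgebra scale bracket hull G (- 1) \<subseteq> L"
    using L L_bracket by (intro hull_minimal) (auto simp: lie_subalgebra_def word_pair_def)
  then have "x \<in> L" using generated G_in_N[OF _ assms(1)] assms(2) by auto
  moreover have "L \<subseteq> {x. \<forall>s\<ge>1. \<exists>m. (component x (- int s), m) \<in> graph \<alpha> s}"
    unfolding L_def
  proof (rule span_minimal)
    show "subspace {x. \<forall>s\<ge>1. \<exists>m. (component x (- int s), m) \<in> graph \<alpha> s}"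
    proof (rule subspaceI)
      show "0 \<in> {x. \<forall>s\<ge>1. \<exists>m. (component x (- int s), m) \<in> graph \<alpha> s}"
        using graph_0 component_homogeneous[OF subspace_0[OF subspace_G]] by (auto simp: zero_prod_def)
    next
      fix x y
      assume "x \<in> {x. \<forall>s\<ge>1. \<exists>m. (component x (- int s), m) \<in> graph \<alpha> s}"
        "y \<in> {x. \<forall>s\<ge>1. \<exists>m. (component x (- int s), m) \<in> graph \<alpha> s}"
      then show "x + y \<in> {x. \<forall>s\<ge>1. \<exists>m. (component x (- int s), m) \<in> graph \<alpha> s}"
        using graph_add by (fastforce simp: component_add)
    next
      fix c x
      assume "x \<in> {x. \<forall>s\<ge>1. \<exists>m. (component x (- int s), m) \<in> graph \<alpha> s}"
      then show "scale c x \<in> {x. \<forall>s\<ge>1. \<exists>m. (component x (- int s), m) \<in> graph \<alpha> s}"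
        using graph_scale[of _ _ c] by (fastforce simp: component_scale)
    qed
    have "\<exists>m. (component (fst p) (- int t), m) \<in> graph \<alpha> t" if "p \<in> graph \<alpha> s" "s \<ge> 1" for p s t
      using component_homogeneous[OF graph_homogeneous(1)[OF that], of "- int t"] that graph_0[of \<alpha> t]
      by (cases p) (auto simp: zero_prod_def)
    then show "(\<Union>s\<in>{1..}. fst ` graph \<alpha> s) \<subseteq> {x. \<forall>s\<ge>1. \<exists>m. (component x (- int s), m) \<in> graph \<alpha> s}"
      by auto
  qed
  ultimately have "\<exists>m. (component x (- int s), m) \<in> graph \<alpha> s" using assms(2) by blast
  then show ?thesis using component_homogeneous[OF assms(1)] by simp
qed

end

lemma sum_word_value_cocycle:
  assumes D: "D \<in> cocycles l" and ws: "set ws \<subseteq> words G s" "s \<ge> 1"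
  shows "(\<Sum>xs\<leftarrow>ws. word_value (generator_part D) xs) = D (\<Sum>xs\<leftarrow>ws. ad_word bracket xs)"
  using ws
proof (induction ws)
  case Nil
  have "D (0 + 0) = D 0 + D 0"
    using D subspace_0[OF subspace_N] unfolding cocycles_def Hom_def by blast
  then show ?case by simp
next
  case (Cons xs ws)
  have "word_value (generator_part D) xs = word_value D xs"
    using Cons by (intro word_value_cong) (auto simp: generator_part_def words_def)
  also have "\<dots> = D (ad_word bracket xs)"
    using word_value_cocycle[OF D _ Cons(3), of xs] Cons by simp
  finally have 1: "word_value (generator_part D) xs = D (ad_word bracket xs)" .
  have N: "ad_word bracket xs \<in> N" if "xs \<in> words G s" for xs
    using ad_word_G[OF that Cons(3)] Cons(3) by (intro G_in_N[of "- int s"]) auto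
  have "(\<Sum>xs\<leftarrow>ws. ad_word bracket xs) \<in> N"
    using Cons(2) N
    by (induction ws) (auto intro: subspace_add[OF subspace_N] subspace_0[OF subspace_N])
  then show ?case using Cons 1 D N[of xs] by (simp add: cocycles_def Hom_def)
qed

lemma generator_part_extendable:
  assumes D: "D \<in> cocycles l"
  shows "generator_part D \<in> extendable l"
proof -
  have "D x \<in> Mg (l - 1)" if "x \<in> G (- 1)" for x
  proof -
    have "(- 1 :: int) < 0" by simp
    then have "D x \<in> Mg (- 1 + l)" using D that unfolding cocycles_def by blast
    then show ?thesis by simp
  qed
  then have "generator_part D \<in> Hom scale smul (G (- 1)) (Mg (l - 1))"
    using D G_in_N[of "- 1"]
    by (auto simp: generator_part_def Hom_def cocycles_def subspace_add[OF subspace_G]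
        subspace_scale[OF subspace_G])
  then show ?thesis
    using sum_word_value_cocycle[OF D] by (auto simp: extendable_def ad_words_eq_def)
qed

text \<open>As \<open>graph\<close> depends on the restriction to the generators only and lies over the whole of each
  \<open>G (- s)\<close>, a cocycle is determined by that restriction.\<close>

lemma graph_of_cocycle:
  assumes D: "D \<in> cocycles l" and p: "p \<in> graph (generator_part D) s" "s \<ge> 1"
  shows "D (fst p) = snd p"
  using p
  by (auto simp: graph_def fst_sum_word_pair snd_sum_word_pair sum_word_value_cocycle[OF D])

lemma generator_part_inj: "inj_on generator_part (cocycles l)"
proof (rule inj_onI)
  fix D D' assume D: "D \<in> cocycles l" and D': "D' \<in> cocycles l"
    and eq: "generator_part D = generator_part D'"
  have hom: "generator_part D \<in> Hom scale smul (G (- 1)) (Mg (l - 1))"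
    using generator_part_extendable[OF D] by (simp add: extendable_def)
  have "N \<subseteq> {x\<in>N. D x = D' x}"
  proof (rule N_subset)
    show "subspace {x \<in> N. D x = D' x}"
    proof (rule subspaceI)
      have "D (0 + 0) = D 0 + D 0" "D' (0 + 0) = D' 0 + D' 0"
        using D D' subspace_0[OF subspace_N] unfolding cocycles_def Hom_def by blast+
      then show "0 \<in> {x \<in> N. D x = D' x}" using subspace_0[OF subspace_N] by simp
    qed (use D D' in \<open>auto simp: cocycles_def Hom_def subspace_add[OF subspace_N]
        subspace_scale[OF subspace_N]\<close>)
    fix i x assume i: "i < 0" and x: "x \<in> G i"
    have s: "nat (- i) \<ge> 1" "x \<in> G (- int (nat (- i)))" using i x by auto
    then obtain m where "(x, m) \<in> graph (generator_part D) (nat (- i))"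
      using graph_total[OF hom] by blast
    then show "x \<in> {x \<in> N. D x = D' x}"
      using graph_of_cocycle[OF D, of "(x, m)"] graph_of_cocycle[OF D', of "(x, m)"] s(1)
        G_in_N[OF i x] by (simp add: eq)
  qed
  moreover have "D x = 0" "D' x = 0" if "x \<notin> N" for x
    using D D' that by (simp_all add: cocycles_def Hom_def)
  ultimately have "D x = D' x" for x by (cases "x \<in> N") auto
  then show "D = D'" by blast
qed

text \<open>For an extendable \<open>\<alpha>\<close> the relation \<open>graph \<alpha> s\<close> is functional, and the extension is read off
  from it in each degree. The degrees below \<open>- k\<close> carry no elements but \<open>0\<close>.\<close>

definition homogeneous_extension :: "('a \<Rightarrow> 'm) \<Rightarrow> nat \<Rightarrow> 'a \<Rightarrow> 'm" where
  "homogeneous_extension \<alpha> s x = (THE m. (x, m) \<in> graph \<alpha> s)"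

definition extension :: "('a \<Rightarrow> 'm) \<Rightarrow> 'a \<Rightarrow> 'm" where
  "extension \<alpha> x =
     (if x \<in> N then \<Sum>s\<in>{1..nat k}. homogeneous_extension \<alpha> s (component x (- int s)) else 0)"

context
  fixes \<alpha> l
  assumes ext: "\<alpha> \<in> extendable l"
begin

lemma hom: "\<alpha> \<in> Hom scale smul (G (- 1)) (Mg (l - 1))"
  using ext by (simp add: extendable_def)

text \<open>Two representations of \<open>x\<close> as a sum of words are precisely what the extendability condition
  compares.\<close>

lemma graph_unique:
  assumes "(x, m) \<in> graph \<alpha> s" "(x, n) \<in> graph \<alpha> s" "s \<ge> 1"
  shows "m = n"
proof -
  obtain ws ws' where ws: "set ws \<subseteq> words G s" "(x, m) = (\<Sum>xs\<leftarrow>ws. word_pair \<alpha> xs)"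
    "set ws' \<subseteq> words G s" "(x, n) = (\<Sum>xs\<leftarrow>ws'. word_pair \<alpha> xs)"
    using assms unfolding graph_def by blast
  have "(\<Sum>xs\<leftarrow>ws. ad_word bracket xs) = x" "(\<Sum>xs\<leftarrow>ws. word_value \<alpha> xs) = m"
    "(\<Sum>xs\<leftarrow>ws'. ad_word bracket xs) = x" "(\<Sum>xs\<leftarrow>ws'. word_value \<alpha> xs) = n"
    unfolding fst_sum_word_pair[of \<alpha>, symmetric] snd_sum_word_pair[of \<alpha>, symmetric]
    by (simp_all add: ws(2,4)[symmetric])
  moreover have "ad_words_eq bracket G s ws ws'"
    using ws(1,3) calculation by (simp add: ad_words_eq_def)
  then have "(\<Sum>xs\<leftarrow>ws. word_value \<alpha> xs) = (\<Sum>xs\<leftarrow>ws'. word_value \<alpha> xs)"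
    using ext assms(3) by (simp add: extendable_def)
  ultimately show ?thesis by simp
qed

lemma homogeneous_extension_eq:
  "(x, m) \<in> graph \<alpha> s \<Longrightarrow> s \<ge> 1 \<Longrightarrow> homogeneous_extension \<alpha> s x = m"
  unfolding homogeneous_extension_def by (blast intro: graph_unique)

lemma homogeneous_extension_graph:
  "x \<in> G (- int s) \<Longrightarrow> s \<ge> 1 \<Longrightarrow> (x, homogeneous_extension \<alpha> s x) \<in> graph \<alpha> s"
  using graph_total[OF hom, of x s] homogeneous_extension_eq by auto

lemma homogeneous_extension_add:
  assumes "x \<in> G (- int s)" "y \<in> G (- int s)" "s \<ge> 1"
  shows "homogeneous_extension \<alpha> s (x + y) =
    homogeneous_extension \<alpha> s x + homogeneous_extension \<alpha> s y"
  using graph_add[OF homogeneous_extension_graph[OF assms(1,3)]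
      homogeneous_extension_graph[OF assms(2,3)]] assms(3)
  by (intro homogeneous_extension_eq) simp_all

lemma homogeneous_extension_scale:
  assumes "x \<in> G (- int s)" "s \<ge> 1"
  shows "homogeneous_extension \<alpha> s (scale c x) = smul c (homogeneous_extension \<alpha> s x)"
  using graph_scale[OF hom homogeneous_extension_graph[OF assms], of c] assms(2)
  by (intro homogeneous_extension_eq) simp_all

lemma extension_graph:
  assumes x: "x \<in> G (- int s)" and s: "s \<ge> 1"
  shows "(x, extension \<alpha> x) \<in> graph \<alpha> s"
proof -
  have 0: "homogeneous_extension \<alpha> t 0 = 0" if "t \<ge> 1" for t
    using graph_0[of \<alpha> t] that by (intro homogeneous_extension_eq) (simp_all add: zero_prod_def)
  have "homogeneous_extension \<alpha> t (component x (- int t)) =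
      (if t = s then homogeneous_extension \<alpha> s x else 0)" if "t \<in> {1..nat k}" for t
    using that 0[of t] component_homogeneous[OF x, of "- int t"] by auto
  then have "extension \<alpha> x = (\<Sum>t\<in>{1..nat k}. if t = s then homogeneous_extension \<alpha> s x else 0)"
    using s G_in_N[OF _ x] by (auto simp: extension_def intro!: sum.cong)
  also have "\<dots> = homogeneous_extension \<alpha> s x"
  proof (cases "s \<le> nat k")
    case False
    then have "x = 0" using G_outside[of "- int s"] x by auto
    then show ?thesis using 0[OF s] by simp
  qed (use s in simp)
  finally show ?thesis using homogeneous_extension_graph[OF x s] by simp
qed

lemma extension_add: "x \<in> N \<Longrightarrow> y \<in> N \<Longrightarrow> extension \<alpha> (x + y) = extension \<alpha> x + extension \<alpha> y"
  by (simp add: extension_def subspace_add[OF subspace_N] component_add homogeneous_extension_add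
      component_G sum.distrib)

lemma extension_scale: "x \<in> N \<Longrightarrow> extension \<alpha> (scale c x) = smul c (extension \<alpha> x)"
  by (simp add: extension_def subspace_scale[OF subspace_N] component_scale homogeneous_extension_scale
      component_G M.scale_sum_right)

lemma extension_M: "x \<in> N \<Longrightarrow> extension \<alpha> x \<in> M"
  unfolding extension_def
  using graph_homogeneous(3)[OF hom homogeneous_extension_graph[OF component_G]]
  by (auto intro!: M.subspace_sum[OF subspace_M])

text \<open>For homogeneous \<open>x\<close> and \<open>y\<close> both \<open>semidirect (x, D x) (y, D y)\<close> and \<open>([x, y], D [x, y])\<close>, with \<open>D\<close>
  the extension, lie in the graph over \<open>[x, y]\<close>, so their second components agree. If the degree of
  \<open>[x, y]\<close> is below \<open>- k\<close>, this says that the expression vanishes, which is why the condition of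
  extendability ranges over words of all lengths. The general case follows by bilinearity.\<close>

lemma extension_bracket:
  assumes "x \<in> N" "y \<in> N"
  shows "extension \<alpha> (bracket x y) = act x (extension \<alpha> y) - act y (extension \<alpha> x)"
proof -
  define T where
    "T x = {y\<in>N. extension \<alpha> (bracket x y) = act x (extension \<alpha> y) - act y (extension \<alpha> x)}" for x
  have e0: "extension \<alpha> 0 = 0"
    using extension_scale[OF subspace_0[OF subspace_N], of 0] by simp
  have T: "subspace (T x)" if "x \<in> N" for x
    using that
    by (auto simp: subspace_def T_def subspace_add[OF subspace_N] subspace_scale[OF subspace_N]
        subspace_0[OF subspace_N] bracket_add_right bracket_scale_right extension_add
        extension_scale bracket_N extension_M act_add_left act_scale_left act_add_right
        act_scale_right M.scale_right_diff_distrib e0)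
  have "y \<in> T x" if x: "x \<in> G i" "i < 0" and y: "y \<in> G j" "j < 0" for i j x y
  proof -
    define s t where "s = nat (- i)" and "t = nat (- j)"
    have st: "s \<ge> 1" "t \<ge> 1" "i = - int s" "j = - int t" using that by (auto simp: s_def t_def)
    have "semidirect (x, extension \<alpha> x) (y, extension \<alpha> y) \<in> graph \<alpha> (s + t)"
      using that st by (intro graph_semidirect[OF hom] extension_graph) auto
    moreover have "(bracket x y, extension \<alpha> (bracket x y)) \<in> graph \<alpha> (s + t)"
      using bracket_G[OF x(1) y(1)] st by (intro extension_graph) auto
    ultimately show ?thesis
      using graph_unique[of "bracket x y" _ "s + t"] st G_in_N[OF y(2,1)]
      by (simp add: T_def semidirect_def)
  qed
  then have homogeneous: "N \<subseteq> T x" if "x \<in> G i" "i < 0" for i x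
    using that by (intro N_subset T) (auto intro: G_in_N)
  have "N \<subseteq> {x\<in>N. y \<in> T x}"
  proof (rule N_subset)
    show "subspace {x\<in>N. y \<in> T x}"
      using assms(2)
      by (auto simp: subspace_def T_def subspace_add[OF subspace_N] subspace_scale[OF subspace_N]
          subspace_0[OF subspace_N] bracket_add_left bracket_scale_left extension_add
          extension_scale bracket_N extension_M act_add_left act_scale_left act_add_right
          act_scale_right M.scale_right_diff_distrib e0)
    show "x \<in> {x\<in>N. y \<in> T x}" if "i < 0" "x \<in> G i" for i x
      using G_in_N[OF that] homogeneous[OF that(2,1)] assms(2) by blast
  qed
  then show ?thesis using assms(1) by (auto simp: T_def)
qed

lemma extension_cocycle: "extension \<alpha> \<in> cocycles l"
proof -
  have "extension \<alpha> x \<in> Mg (i + l)" if "i < 0" "x \<in> G i" for i x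
    using graph_homogeneous(2)[OF hom extension_graph[of x "nat (- i)"]] that
    by (simp add: algebra_simps)
  moreover have "extension \<alpha> x = 0" if "x \<notin> N" for x
    using that by (simp add: extension_def)
  ultimately show ?thesis
    by (simp add: cocycles_def Hom_def extension_add extension_scale extension_M extension_bracket)
qed

lemma generator_part_extension: "generator_part (extension \<alpha>) = \<alpha>"
proof
  fix x
  show "generator_part (extension \<alpha>) x = \<alpha> x"
  proof (cases "x \<in> G (- 1)")
    case True
    have "word_pair \<alpha> [x] \<in> graph \<alpha> 1"
      using True by (intro word_pair_graph) (simp add: words_def)
    then have "(x, \<alpha> x) \<in> graph \<alpha> 1" by (simp add: word_pair_def)
    then show ?thesis
      using graph_unique[OF extension_graph[of x 1], of "\<alpha> x"] True
      by (simp add: generator_part_def)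
  qed (use hom in \<open>simp add: generator_part_def Hom_def\<close>)
qed

end

text \<open>Restriction to the generators identifies the cocycles of degree \<open>l\<close> with the maps whose word
  values are compatible with all linear relations between words of equal length.\<close>

theorem bij_betw_generator_part: "bij_betw generator_part (cocycles l) (extendable l)"
proof (rule bij_betw_imageI[OF generator_part_inj])
  show "generator_part ` cocycles l = extendable l"
    using generator_part_extendable extension_cocycle generator_part_extension
    by (metis image_eqI image_subsetI subsetI subset_antisym)
qed

text \<open>The coboundary of the 0-cochain \<open>m\<close>.\<close>

definition principal :: "'m \<Rightarrow> 'a \<Rightarrow> 'm" where
  "principal m x = (if x \<in> N then act x m else 0)"

lemma principal_cocycle:
  assumes "m \<in> Mg l"
  shows "principal m \<in> cocycles l"
  using Mg_M[OF assms] act_Mg[OF _ assms]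
  by (auto simp: cocycles_def Hom_def principal_def bracket_N subspace_add[OF subspace_N]
      subspace_scale[OF subspace_N] act_add_left act_scale_left act_M act_bracket G_in_N)

lemma subspace_cocycles: "module.subspace (fun_scale smul) (cocycles l)"
proof -
  interpret F: vector_space "fun_scale smul"
    by (rule vector_space_fun_scale) unfold_locales
  note Hom = subspace_Hom[OF M.vector_space_axioms subspace_M, of scale N]
  have M: "D x \<in> M" if "D \<in> Hom scale smul N M" for D x
    using that M.subspace_0[OF subspace_M] by (cases "x \<in> N") (auto simp: Hom_def)
  show ?thesis
  proof (rule F.subspaceI)
    show "0 \<in> cocycles l"
      using F.subspace_0[OF Hom] by (simp add: cocycles_def M.subspace_0[OF subspace_Mg])
    show "D + E \<in> cocycles l" if "D \<in> cocycles l" "E \<in> cocycles l" for D E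
      using that F.subspace_add[OF Hom]
      by (simp add: cocycles_def M.subspace_add[OF subspace_Mg] act_add_right M)
    show "fun_scale smul c D \<in> cocycles l" if "D \<in> cocycles l" for c D
      using that F.subspace_scale[OF Hom]
      by (simp add: cocycles_def fun_scale_def M.subspace_scale[OF subspace_Mg] act_scale_right M
          M.scale_right_diff_distrib)
  qed
qed

end

section \<open>The cotangent Lie algebra as a module\<close>

lemma vector_space_cot_scale:
  assumes "vector_space scale"
  shows "vector_space (cot_scale scale)"
proof -
  interpret vector_space scale by fact
  show ?thesis
    by unfold_locales
      (auto simp: cot_scale_def fun_scale_def fun_eq_iff scale_right_distrib scale_left_distrib
        distrib_left distrib_right zero_prod_def)
qed

lemma vector_space_fun_scale_field: "vector_space (fun_scale ((*) :: 'k::field \<Rightarrow> 'k \<Rightarrow> 'k))"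
  by unfold_locales (auto simp: fun_scale_def fun_eq_iff distrib_left distrib_right)

lemma Hom_pair_iff:
  "\<alpha> \<in> Hom s1 (cot_scale s2) U (A \<times> B) \<longleftrightarrow>
    (\<lambda>x. fst (\<alpha> x)) \<in> Hom s1 s2 U A \<and> (\<lambda>x. snd (\<alpha> x)) \<in> Hom s1 (fun_scale (*)) U B"
  by (auto simp: Hom_def cot_scale_def prod_eq_iff mem_Times_iff split_beta)

lemma sum_list_apply: "(\<Sum>x\<leftarrow>xs. f x) z = (\<Sum>x\<leftarrow>xs. f x z)"
  for f :: "'x \<Rightarrow> 'z \<Rightarrow> 'c::comm_monoid_add"
  by (induction xs) auto

context fundamental_lie_algebra
begin

abbreviation H :: "int \<Rightarrow> ('a \<times> ('a \<Rightarrow> 'k)) set" where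
  "H \<equiv> cot_grading scale G"

definition cot_act :: "'a \<Rightarrow> 'a \<times> ('a \<Rightarrow> 'k) \<Rightarrow> 'a \<times> ('a \<Rightarrow> 'k)" where
  "cot_act x m = (bracket x (fst m), coad bracket x (snd m))"

lemma dual_iff:
  "\<xi> \<in> dual scale \<longleftrightarrow> (\<forall>x y. \<xi> (x + y) = \<xi> x + \<xi> y) \<and> (\<forall>c x. \<xi> (scale c x) = c * \<xi> x)"
  using vector_space_axioms vector_space_fun_scale_field
  by (auto simp: dual_def Vector_Spaces.linear_iff vector_space_def distrib_left distrib_right)

lemma dual_zero: "\<xi> \<in> dual scale \<Longrightarrow> \<xi> 0 = 0"
  unfolding dual_iff by (metis mult_zero_left scale_zero_left)

lemma dual_diff: "\<xi> \<in> dual scale \<Longrightarrow> \<xi> (x - y) = \<xi> x - \<xi> y"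
  unfolding dual_iff by (metis add_diff_cancel_right' diff_add_cancel)

lemma subspace_dual: "module.subspace (fun_scale (*)) (dual scale)"
proof -
  interpret F: vector_space "fun_scale ((*) :: 'k \<Rightarrow> 'k \<Rightarrow> 'k)"
    by (rule vector_space_fun_scale_field)
  show ?thesis by (auto simp: F.subspace_def dual_iff fun_scale_def algebra_simps)
qed

lemma subspace_dual_comp: "module.subspace (fun_scale (*)) (dual_comp scale G j)"
proof -
  interpret F: vector_space "fun_scale ((*) :: 'k \<Rightarrow> 'k \<Rightarrow> 'k)"
    by (rule vector_space_fun_scale_field)
  show ?thesis
    using subspace_dual by (auto simp: F.subspace_def dual_comp_def fun_scale_def)
qed

text \<open>A functional of \<open>dual_comp\<close> is an extension by \<open>0\<close>, so its values on one homogeneous component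
  determine it.\<close>

lemma dual_comp_eqI:
  assumes "\<xi> \<in> dual_comp scale G j" "\<eta> \<in> dual_comp scale G j" "\<And>x. x \<in> G j \<Longrightarrow> \<xi> x = \<eta> x"
  shows "\<xi> = \<eta>"
proof
  fix x
  have sum: "\<zeta> (sum f A) = (\<Sum>i\<in>A. \<zeta> (f i))" if "\<zeta> \<in> dual scale" for \<zeta> f and A :: "int set"
    using that by (induction A rule: infinite_finite_induct) (auto simp: dual_zero dual_iff)
  have "\<xi> (component x i) = \<eta> (component x i)" for i
    using assms component_G[of x i] by (cases "i = j") (auto simp: dual_comp_def)
  then have "\<xi> (\<Sum>i\<in>{- k..0}. component x i) = \<eta> (\<Sum>i\<in>{- k..0}. component x i)"
    using assms(1,2) by (simp add: dual_comp_def sum)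
  then show "\<xi> x = \<eta> x" by (simp add: sum_component)
qed

lemma dual_comp_trivial:
  assumes "G j = {0}"
  shows "dual_comp scale G j = {0}"
proof -
  have "0 \<in> dual_comp scale G j" by (simp add: dual_comp_def dual_iff)
  moreover have "\<xi> = 0" if "\<xi> \<in> dual_comp scale G j" for \<xi>
    using that calculation assms
    by (intro dual_comp_eqI) (auto simp: dual_comp_def dual_zero)
  ultimately show ?thesis by auto
qed

text \<open>The three cases of the gradation have one uniform description, because \<open>G j\<close> and its dual are
  zero for \<open>j > 0\<close>.\<close>

lemma H_eq: "H i = G i \<times> dual_comp scale G (- i)"
proof -
  have "G j = {0}" "dual_comp scale G j = {0}" if "j > 0" for j
    using G_outside[of j] dual_comp_trivial that by auto
  then show ?thesis by (simp add: cot_grading_def)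
qed

lemma cot_act_pair: "cot_act x (y, \<xi>) = (bracket x y, coad bracket x \<xi>)"
  by (simp add: cot_act_def)

lemma cot_bracket_eq_act: "cot_bracket bracket (x, 0) m = cot_act x m"
  by (simp add: cot_act_def cot_bracket_def coad_def split_beta fun_eq_iff)

lemma coad_dual: "\<xi> \<in> dual scale \<Longrightarrow> coad bracket x \<xi> \<in> dual scale"
  by (simp add: dual_iff coad_def bracket_add_right bracket_scale_right)

lemma coad_dual_comp:
  assumes "x \<in> G i" "\<xi> \<in> dual_comp scale G (- j)"
  shows "coad bracket x \<xi> \<in> dual_comp scale G (- (i + j))"
proof -
  have "\<xi> (bracket x y) = 0" if "t \<noteq> - (i + j)" "y \<in> G t" for t y
  proof -
    have "i + t \<noteq> - j" using that(1) by linarith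
    then show ?thesis
      using bracket_G[OF assms(1) that(2)] assms(2) unfolding dual_comp_def by blast
  qed
  then show ?thesis
    using assms(2) coad_dual[of \<xi> x] by (auto simp: dual_comp_def coad_def)
qed

sublocale cot: graded_coefficients scale bracket k G "cot_scale scale" cot_act
  "UNIV \<times> dual scale" "cot_grading scale G"
proof -
  interpret C: vector_space "cot_scale scale"
    by (rule vector_space_cot_scale) unfold_locales
  interpret F: vector_space "fun_scale ((*) :: 'k \<Rightarrow> 'k \<Rightarrow> 'k)"
    by (rule vector_space_fun_scale_field)
  have subspace_Times: "C.subspace (A \<times> B)" if "subspace A" "F.subspace B" for A B
    using that by (auto simp: C.subspace_def subspace_def F.subspace_def cot_scale_def zero_prod_def)
  show "graded_coefficients scale bracket k G (cot_scale scale) cot_act (UNIV \<times> dual scale) H"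
  proof unfold_locales
    show "C.subspace (UNIV \<times> dual scale)"
      by (rule subspace_Times[OF _ subspace_dual]) simp
    show "C.subspace (H j)" for j
      unfolding H_eq by (rule subspace_Times[OF subspace_G subspace_dual_comp])
    show "m \<in> H j \<Longrightarrow> m \<in> UNIV \<times> dual scale" for m j
      by (auto simp: H_eq dual_comp_def)
    show "m \<in> UNIV \<times> dual scale \<Longrightarrow> cot_act x m \<in> UNIV \<times> dual scale" for x m
      by (auto simp: cot_act_def coad_dual)
    show "x \<in> G i \<Longrightarrow> m \<in> H j \<Longrightarrow> cot_act x m \<in> H (i + j)" for x i m j
      using bracket_G coad_dual_comp unfolding H_eq cot_act_def by (auto simp: mem_Times_iff)
    show "m \<in> UNIV \<times> dual scale \<Longrightarrow> cot_act (bracket x y) m =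
        cot_act x (cot_act y m) - cot_act y (cot_act x m)" for m x y
      by (auto simp: cot_act_def bracket_bracket coad_def dual_diff fun_eq_iff)
  qed (auto simp: cot_act_def cot_scale_def fun_scale_def coad_def bracket_add_left
      bracket_add_right bracket_scale_left bracket_scale_right dual_iff fun_eq_iff)
qed

lemma bracket_sum_right: "bracket x (\<Sum>i\<in>A. f i) = (\<Sum>i\<in>A. bracket x (f i))"
  by (induction A rule: infinite_finite_induct) (simp_all add: bracket_add_right)

text \<open>The recursions for \<open>S_expr\<close> and \<open>Z_expr\<close> are those of \<open>word_value\<close> for the adjoint and for the
  coadjoint module; the minus sign of the coadjoint action produces the alternating signs.\<close>

lemma S_expr_Cons:
  "S_expr bracket f (x # y # ys) =
    bracket (f x) (ad_word bracket (y # ys)) + bracket x (S_expr bracket f (y # ys))"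
proof -
  have len: "length (x # y # ys) = Suc (length (y # ys))" by simp
  have "ad_word bracket ((x # y # ys)[Suc i := z]) = bracket x (ad_word bracket ((y # ys)[i := z]))"
    for i z
    by (cases i) simp_all
  then show ?thesis
    unfolding S_expr_def len sum.lessThan_Suc_shift bracket_sum_right by simp
qed

lemma Z_expr_Cons:
  "Z_expr bracket \<alpha> (x # y # ys) z =
    \<alpha> x (bracket (ad_word bracket (y # ys)) z) - Z_expr bracket \<alpha> (y # ys) (bracket x z)"
proof -
  let ?g = "\<lambda>i. (- 1) ^ i * \<alpha> ((y # ys) ! i)
    (ad_tail bracket (drop (Suc i) (y # ys)) (fold bracket (take i (y # ys)) (bracket x z)))"
  have len: "length (x # y # ys) = Suc (length (y # ys))" by simp
  have "Z_expr bracket \<alpha> (x # y # ys) z =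
    \<alpha> x (bracket (ad_word bracket (y # ys)) z) + (\<Sum>i<length (y # ys). - ?g i)"
    unfolding Z_expr_def len sum.lessThan_Suc_shift by (simp add: ad_tail_def del: sum.lessThan_Suc)
  then show ?thesis unfolding Z_expr_def sum_negf by simp
qed

lemma word_value_cot:
  "xs \<noteq> [] \<Longrightarrow> cot.word_value (\<lambda>x. (f x, \<phi> x)) xs = (S_expr bracket f xs, Z_expr bracket \<phi> xs)"
proof (induction xs rule: induct_list012)
  case (2 x)
  then show ?case by (simp add: S_expr_def Z_expr_def ad_tail_def fun_eq_iff)
next
  case (3 x y ys)
  then show ?case
    using bracket_antisym[of "f x" "ad_word bracket (y # ys)"]
    by (simp add: cot_act_pair S_expr_Cons fun_eq_iff Z_expr_Cons coad_def)
qed simp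

text \<open>Lengths of words outside of \<open>2 \<le> s \<le> l\<close> give no further conditions: for \<open>s = 1\<close> the condition is
  the additivity of \<open>\<phi>\<close>, and for \<open>s > l\<close> both sides are functionals in \<open>dual_comp scale G (s - l)\<close>,
  which is zero. Similarly it suffices to compare values on \<open>G (s - l)\<close>, as both sides vanish on the other
  components.\<close>

lemma Z_space_iff:
  assumes \<phi>: "\<phi> \<in> Hom scale (fun_scale (*)) (G (- 1)) (dual_comp scale G (1 - l))"
  shows "\<phi> \<in> Z_space scale bracket G l \<longleftrightarrow>
    (\<forall>s\<ge>1. \<forall>ws ws'. ad_words_eq bracket G s ws ws' \<longrightarrow>
      (\<Sum>xs\<leftarrow>ws. Z_expr bracket \<phi> xs) = (\<Sum>xs\<leftarrow>ws'. Z_expr bracket \<phi> xs))"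
    (is "_ \<longleftrightarrow> ?R")
proof
  assume ?R
  moreover have "s \<ge> 1" if "2 \<le> s" for s :: nat using that by simp
  ultimately show "\<phi> \<in> Z_space scale bracket G l"
    using \<phi> unfolding Z_space_def sum_list_apply[symmetric] by fastforce
next
  assume Z: "\<phi> \<in> Z_space scale bracket G l"
  interpret F: vector_space "fun_scale ((*) :: 'k \<Rightarrow> 'k \<Rightarrow> 'k)"
    by (rule vector_space_fun_scale_field)
  have hom: "(\<lambda>x. (0, \<phi> x)) \<in> Hom scale (cot_scale scale) (G (- 1)) (H (l - 1))"
    using \<phi> by (simp add: H_eq Hom_pair_iff) (simp add: Hom_def subspace_0[OF subspace_G])
  have dual_comp: "(\<Sum>xs\<leftarrow>ws. Z_expr bracket \<phi> xs) \<in> dual_comp scale G (int s - l)"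
    if "set ws \<subseteq> words G s" "s \<ge> 1" for ws s
    using that(1)
  proof (induction ws)
    case (Cons xs ws)
    then have "cot.word_value (\<lambda>x. (0, \<phi> x)) xs \<in> H (l - int s)"
      using that(2) by (intro cot.word_value_Mg[OF hom]) auto
    moreover have "xs \<noteq> []" using wordsD(1) Cons(2) that(2) by auto
    ultimately have "Z_expr bracket \<phi> xs \<in> dual_comp scale G (int s - l)"
      by (simp add: word_value_cot H_eq)
    then show ?case using Cons F.subspace_add[OF subspace_dual_comp] by (simp add: plus_fun_def)
  qed (simp add: F.subspace_0[OF subspace_dual_comp])
  have single: "(\<Sum>xs\<leftarrow>ws. Z_expr bracket \<phi> xs) = \<phi> (\<Sum>xs\<leftarrow>ws. ad_word bracket xs)
      \<and> (\<Sum>xs\<leftarrow>ws. ad_word bracket xs) \<in> G (- 1)"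
    if "set ws \<subseteq> words G 1" for ws
    using that
  proof (induction ws)
    case Nil
    have "\<phi> (0 + 0) = \<phi> 0 + \<phi> 0"
      using \<phi> subspace_0[OF subspace_G] unfolding Hom_def by blast
    then show ?case using subspace_0[OF subspace_G] by simp
  next
    case (Cons xs ws)
    obtain x where x: "xs = [x]" "x \<in> G (- 1)"
      using Cons(2) by (auto simp: words_def length_Suc_conv)
    then have "Z_expr bracket \<phi> xs = \<phi> x" by (simp add: Z_expr_def ad_tail_def fun_eq_iff)
    then show ?case
      using Cons x \<phi> by (auto simp: Hom_def intro: subspace_add[OF subspace_G])
  qed
  show ?R
  proof (intro allI impI)
    fix s ws ws' assume s: "1 \<le> (s::nat)" and eq: "ad_words_eq bracket G s ws ws'"
    have ws: "set ws \<subseteq> words G s" "set ws' \<subseteq> words G s"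
      using eq by (simp_all add: ad_words_eq_def)
    consider "s = 1" | "2 \<le> s" "int s \<le> l" | "int s > l" using s by linarith
    then show "(\<Sum>xs\<leftarrow>ws. Z_expr bracket \<phi> xs) = (\<Sum>xs\<leftarrow>ws'. Z_expr bracket \<phi> xs)"
    proof cases
      case 1
      then show ?thesis using single ws eq by (simp add: ad_words_eq_def)
    next
      case 2
      then have "(\<Sum>xs\<leftarrow>ws. Z_expr bracket \<phi> xs z) = (\<Sum>xs\<leftarrow>ws'. Z_expr bracket \<phi> xs z)"
        if "z \<in> G (int s - l)" for z
        using Z eq that by (simp add: Z_space_def)
      then show ?thesis
        using dual_comp[OF ws(1) s] dual_comp[OF ws(2) s]
        by (intro dual_comp_eqI) (simp_all add: sum_list_apply)
    next
      case 3
      then show ?thesis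
        using dual_comp[OF ws(1) s] dual_comp[OF ws(2) s] dual_comp_trivial[OF G_outside, of "int s - l"]
        by simp
    qed
  qed
qed

lemma extendable_iff:
  assumes "l \<ge> 1"
  shows "\<alpha> \<in> cot.extendable l \<longleftrightarrow>
    (\<lambda>x. fst (\<alpha> x)) \<in> (if l = 1 then S_space scale bracket G else {0}) \<and>
    (\<lambda>x. snd (\<alpha> x)) \<in> Z_space scale bracket G l"
proof -
  let ?f = "\<lambda>x. fst (\<alpha> x)" and ?\<phi> = "\<lambda>x. snd (\<alpha> x)"
  let ?HS = "?f \<in> Hom scale scale (G (- 1)) (G (l - 1))"
  let ?HZ = "?\<phi> \<in> Hom scale (fun_scale (*)) (G (- 1)) (dual_comp scale G (1 - l))"
  let ?S = "\<forall>s\<ge>1. \<forall>ws ws'. ad_words_eq bracket G s ws ws' \<longrightarrow>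
    (\<Sum>xs\<leftarrow>ws. S_expr bracket ?f xs) = (\<Sum>xs\<leftarrow>ws'. S_expr bracket ?f xs)"
  let ?Z = "\<forall>s\<ge>1. \<forall>ws ws'. ad_words_eq bracket G s ws ws' \<longrightarrow>
    (\<Sum>xs\<leftarrow>ws. Z_expr bracket ?\<phi> xs) = (\<Sum>xs\<leftarrow>ws'. Z_expr bracket ?\<phi> xs)"
  have sums: "(\<Sum>xs\<leftarrow>ws. cot.word_value \<alpha> xs) =
      (\<Sum>xs\<leftarrow>ws. S_expr bracket ?f xs, \<Sum>xs\<leftarrow>ws. Z_expr bracket ?\<phi> xs)"
    if "set ws \<subseteq> words G s" "s \<ge> 1" for ws s
    using that(1)
  proof (induction ws)
    case (Cons xs ws)
    then show ?case
      using wordsD(1)[of xs s] that(2) word_value_cot[of xs ?f ?\<phi>] by (simp add: plus_fun_def)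
  qed (simp add: zero_prod_def)
  have sums_eq: "(\<Sum>xs\<leftarrow>ws. cot.word_value \<alpha> xs) = (\<Sum>xs\<leftarrow>ws'. cot.word_value \<alpha> xs) \<longleftrightarrow>
      (\<Sum>xs\<leftarrow>ws. S_expr bracket ?f xs) = (\<Sum>xs\<leftarrow>ws'. S_expr bracket ?f xs) \<and>
      (\<Sum>xs\<leftarrow>ws. Z_expr bracket ?\<phi> xs) = (\<Sum>xs\<leftarrow>ws'. Z_expr bracket ?\<phi> xs)"
    if "ad_words_eq bracket G s ws ws'" "1 \<le> s" for s ws ws'
    using that sums[of ws s] sums[of ws' s] by (simp add: ad_words_eq_def)
  have "(\<forall>s\<ge>1. \<forall>ws ws'. ad_words_eq bracket G s ws ws' \<longrightarrow>
       (\<Sum>xs\<leftarrow>ws. cot.word_value \<alpha> xs) = (\<Sum>xs\<leftarrow>ws'. cot.word_value \<alpha> xs)) \<longleftrightarrow> ?S \<and> ?Z"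
    by (auto simp: sums_eq)
  then have "\<alpha> \<in> cot.extendable l \<longleftrightarrow> (?HS \<and> ?S) \<and> (?HZ \<and> ?Z)"
    unfolding cot.extendable_def H_eq mem_Collect_eq Hom_pair_iff by simp blast
  moreover have "?HZ \<and> ?Z \<longleftrightarrow> ?\<phi> \<in> Z_space scale bracket G l"
    using Z_space_iff[of ?\<phi> l] by (auto simp: Z_space_def)
  moreover have "?HS \<and> ?S \<longleftrightarrow> ?f \<in> (if l = 1 then S_space scale bracket G else {0})"
  proof (cases "l = 1")
    case True
    then show ?thesis by (simp add: S_space_def)
  next
    case False
    then have G0: "G (l - 1) = {0}" using assms G_outside[of "l - 1"] by simp
    \<comment> \<open>The target \<open>G (l - 1)\<close> is zero, so only \<open>f = 0\<close> remains, and it satisfies the condition.\<close>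
    have "?S" if "?f = 0"
    proof -
      have "S_expr bracket 0 xs = 0" for xs
      proof (induction xs rule: induct_list012)
        case (3 x y ys)
        then show ?case by (simp add: S_expr_Cons)
      qed (simp_all add: S_expr_def)
      then show ?thesis using that by simp
    qed
    moreover have "?HS \<longleftrightarrow> ?f = 0"
      by (auto simp: G0 Hom_def fun_eq_iff)
    ultimately show ?thesis using False by auto
  qed
  ultimately show ?thesis by blast
qed

section \<open>Cochains of degree 0 and 1 of the cotangent Lie algebra\<close>

abbreviation NH :: "('a \<times> ('a \<Rightarrow> 'k)) set" where
  "NH \<equiv> negative_part (cot_scale scale) H"

lemma NH_eq: "NH = N \<times> {0}"
proof -
  have H_neg: "H i = G i \<times> {0}" if "i < 0" for i using that by (simp add: cot_grading_def)
  have span: "NH = cot.M.span (\<Union>i\<in>{..<0}. H i)" by (simp add: negative_part_def)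
  show ?thesis
  proof
    show "NH \<subseteq> N \<times> {0}"
      unfolding span
    proof (rule cot.M.span_minimal)
      show "(\<Union>i\<in>{..<0}. H i) \<subseteq> N \<times> {0}" using G_in_N by (auto simp: H_neg)
      show "cot.M.subspace (N \<times> {0})"
        using subspace_N
        by (auto simp: cot.M.subspace_def subspace_def cot_scale_def fun_scale_def zero_prod_def)
    qed
    have "N \<subseteq> {x. (x, 0) \<in> NH}"
    proof (rule N_subset)
      have "(x + y, 0) \<in> NH" if "(x, 0) \<in> NH" "(y, 0) \<in> NH" for x y
        using cot.M.span_add[OF that[unfolded span]] by (simp add: span)
      moreover have "(scale c x, 0) \<in> NH" if "(x, 0) \<in> NH" for c x
        using cot.M.span_scale[OF that[unfolded span], of c]
        by (simp add: span cot_scale_def fun_scale_def zero_fun_def)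
      moreover have "(0, 0) \<in> NH"
        using cot.M.span_zero by (simp add: span zero_prod_def)
      ultimately show "subspace {x. (x, 0) \<in> NH}" by (simp add: subspace_def)
      show "x \<in> {x. (x, 0) \<in> NH}" if "i < 0" "x \<in> G i" for i x
        using that cot.M.span_base[of "(x, 0)" "\<Union>i\<in>{..<0}. H i"] by (auto simp: span H_neg)
    qed
    then show "N \<times> {0} \<subseteq> NH" by auto
  qed
qed

text \<open>The passage between 1-cochains, which are functions of lists of elements of \<open>h\<^sub>-\<close>, and maps on \<open>g\<^sub>-\<close>.\<close>

definition cochain_of :: "('a \<Rightarrow> 'a \<times> ('a \<Rightarrow> 'k))
    \<Rightarrow> ('a \<times> ('a \<Rightarrow> 'k)) list \<Rightarrow> 'a \<times> ('a \<Rightarrow> 'k)" where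
  "cochain_of D xs = (if length xs = 1 \<and> set xs \<subseteq> NH then D (fst (hd xs)) else 0)"

definition map_of_cochain :: "(('a \<times> ('a \<Rightarrow> 'k)) list \<Rightarrow> 'a \<times> ('a \<Rightarrow> 'k))
    \<Rightarrow> 'a \<Rightarrow> 'a \<times> ('a \<Rightarrow> 'k)" where
  "map_of_cochain \<omega> x = (if x \<in> N then \<omega> [(x, 0)] else 0)"

abbreviation cocycles_h :: "int \<Rightarrow> (('a \<times> ('a \<Rightarrow> 'k)) list \<Rightarrow> 'a \<times> ('a \<Rightarrow> 'k)) set" where
  "cocycles_h l \<equiv> {\<omega> \<in> cochains_deg (cot_scale scale) H 1 l.
     ce_diff (cot_scale scale) (cot_bracket bracket) H \<omega> = 0}"

lemma span_H_subset: "cot.M.span (\<Union>i. H i) \<subseteq> UNIV \<times> dual scale"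
  using cot.Mg_M cot.subspace_M by (intro cot.M.span_minimal) auto

lemma cochains_1_iff:
  "\<omega> \<in> cochains (cot_scale scale) H 1 \<longleftrightarrow>
    \<omega> = cochain_of (map_of_cochain \<omega>) \<and>
    map_of_cochain \<omega> \<in> Hom scale (cot_scale scale) N (cot.M.span (\<Union>i. H i))"
    (is "_ \<longleftrightarrow> ?A \<and> ?B")
proof -
  let ?S = "cot.M.span (\<Union>i. H i)"
  have A: "?A \<longleftrightarrow> (\<forall>xs. \<not> (length xs = 1 \<and> set xs \<subseteq> NH) \<longrightarrow> \<omega> xs = 0)"
    by (auto simp: fun_eq_iff cochain_of_def map_of_cochain_def NH_eq length_Suc_conv)
  have B: "?B \<longleftrightarrow> (\<forall>p\<in>NH. \<omega> [p] \<in> ?S) \<and>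
      (\<lambda>p. if p \<in> NH then \<omega> [p] else 0) \<in> Hom (cot_scale scale) (cot_scale scale) NH UNIV"
    using subspace_N
    by (auto simp: Hom_def map_of_cochain_def NH_eq subspace_def cot_scale_def fun_scale_def
        zero_fun_def)
  have one: "(\<forall>xs. length xs = 1 \<and> set xs \<subseteq> NH \<longrightarrow> P xs) \<longleftrightarrow> (\<forall>p\<in>NH. P [p])" for P
    by (auto simp: length_Suc_conv)
  have ne: "NH \<noteq> {}" using subspace_0[OF subspace_N] by (auto simp: NH_eq)
  have upd: "(\<lambda>x. if x \<in> NH then \<omega> ([p][0 := x]) else 0) = (\<lambda>x. if x \<in> NH then \<omega> [x] else 0)"
    for p
    by (simp add: fun_eq_iff)
  show ?thesis
    unfolding cochains_def mem_Collect_eq one A B using ne by (auto simp: upd)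
qed

text \<open>A cochain of a fixed degree takes values in the span of the homogeneous components because its
  arguments are sums of homogeneous elements, so the span may be replaced by all of \<open>h\<close>.\<close>

lemma cochains_deg_1_iff:
  "\<omega> \<in> cochains_deg (cot_scale scale) H 1 l \<longleftrightarrow>
    \<omega> = cochain_of (map_of_cochain \<omega>) \<and>
    map_of_cochain \<omega> \<in> Hom scale (cot_scale scale) N (UNIV \<times> dual scale) \<and>
    (\<forall>i<0. \<forall>x\<in>G i. map_of_cochain \<omega> x \<in> H (i + l))"
proof -
  let ?S = "cot.M.span (\<Union>i. H i)" and ?D = "map_of_cochain \<omega>"
  have "(\<forall>ss xs. length ss = 1 \<and> list_all2 (\<lambda>s x. s < 0 \<and> x \<in> H s) ss xs
      \<longrightarrow> \<omega> xs \<in> H (sum_list ss + l)) \<longleftrightarrow> (\<forall>i<0. \<forall>p\<in>H i. \<omega> [p] \<in> H (i + l))"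
    (is "?L \<longleftrightarrow> ?R")
  proof
    show ?R if ?L
    proof (intro allI impI ballI)
      fix i p assume "i < (0::int)" "p \<in> H i"
      then show "\<omega> [p] \<in> H (i + l)" using that[rule_format, of "[i]" "[p]"] by simp
    qed
    show ?L if ?R
      using that by (auto simp: length_Suc_conv list_all2_Cons1)
  qed
  also have "\<dots> \<longleftrightarrow> (\<forall>i<0. \<forall>x\<in>G i. ?D x \<in> H (i + l))"
    using G_in_N by (auto simp: cot_grading_def[of _ _ "_::int"] map_of_cochain_def)
  finally have deg: "(\<forall>ss xs. length ss = 1 \<and> list_all2 (\<lambda>s x. s < 0 \<and> x \<in> H s) ss xs
      \<longrightarrow> \<omega> xs \<in> H (sum_list ss + l)) \<longleftrightarrow> (\<forall>i<0. \<forall>x\<in>G i. ?D x \<in> H (i + l))" .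
  have "?D \<in> Hom scale (cot_scale scale) N ?S"
    if D: "?D \<in> Hom scale (cot_scale scale) N (UNIV \<times> dual scale)"
      "\<forall>i<0. \<forall>x\<in>G i. ?D x \<in> H (i + l)"
  proof -
    have "N \<subseteq> {x\<in>N. ?D x \<in> ?S}"
    proof (rule N_subset)
      have "?D (scale 0 0) = cot_scale scale 0 (?D 0)"
        using D(1) subspace_0[OF subspace_N] unfolding Hom_def by blast
      then have "?D 0 = 0" by simp
      then show "subspace {x\<in>N. ?D x \<in> ?S}"
        using D(1) subspace_N cot.M.span_zero cot.M.span_add cot.M.span_scale
        by (auto simp: subspace_def Hom_def)
      show "x \<in> {x\<in>N. ?D x \<in> ?S}" if "i < 0" "x \<in> G i" for i x
        using D(2) that G_in_N cot.M.span_base[of "?D x" "\<Union>i. H i"] by auto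
    qed
    then show ?thesis using D(1) by (auto simp: Hom_def)
  qed
  moreover have "?D \<in> Hom scale (cot_scale scale) N (UNIV \<times> dual scale)"
    if "?D \<in> Hom scale (cot_scale scale) N ?S"
    using that span_H_subset by (auto simp: Hom_def)
  ultimately show ?thesis
    unfolding cochains_deg_def mem_Collect_eq deg cochains_1_iff by blast
qed

text \<open>The differential of a 1-cochain is supported on lists of length two: a list of length \<open>n\<close>
  leads to values of the cochain on lists of length \<open>n - 1\<close>.\<close>

lemma ce_diff_1_zero_iff:
  assumes \<omega>: "\<omega> = cochain_of D"
  shows "ce_diff (cot_scale scale) (cot_bracket bracket) H \<omega> = 0 \<longleftrightarrow>
    (\<forall>x\<in>N. \<forall>y\<in>N. D (bracket x y) = cot_act x (D y) - cot_act y (D x))"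
proof -
  let ?d = "ce_diff (cot_scale scale) (cot_bracket bracket) H \<omega>"
  have \<omega>0: "\<omega> xs = 0" if "length xs \<noteq> 1" for xs using that by (simp add: \<omega> cochain_of_def)
  have \<omega>1: "\<omega> [(x, 0)] = D x" if "x \<in> N" for x using that by (simp add: \<omega> cochain_of_def NH_eq)
  have outside: "?d xs = 0" if "\<not> (length xs = 2 \<and> set xs \<subseteq> NH)" for xs
  proof (cases "set xs \<subseteq> NH")
    case True
    then have len: "length xs \<noteq> 2" using that by blast
    have "cot_bracket bracket (xs ! i) (\<omega> (drop_nth i xs)) = 0" if i: "i < length xs" for i
    proof -
      have "\<omega> (drop_nth i xs) = 0" using i len by (intro \<omega>0) (auto simp: drop_nth_def)
      moreover obtain x where "xs ! i = (x, 0)"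
        using True nth_mem[OF i] by (auto simp: NH_eq)
      ultimately show ?thesis by (simp add: cot_bracket_eq_act)
    qed
    moreover have "\<omega> (p # drop_nth i (drop_nth j xs)) = 0" if "i < j" "j < length xs" for p i j
      using that len by (intro \<omega>0) (auto simp: drop_nth_def)
    ultimately show ?thesis by (simp add: ce_diff_def split_beta)
  qed (simp add: ce_diff_def)
  have pairs: "{(i, j). i < j \<and> j < Suc (Suc 0)} = {(0, Suc 0)}" by auto
  have two: "?d [(x, 0), (y, 0)] = cot_act x (D y) - cot_act y (D x) - D (bracket x y)"
    if "x \<in> N" "y \<in> N" for x y
  proof -
    have "cot_act x (y, 0) = (bracket x y, 0)"
      by (simp add: cot_act_pair coad_def zero_fun_def)
    then show ?thesis
      using that bracket_N[OF that]
      by (simp add: ce_diff_def NH_eq pairs drop_nth_def \<omega>1 cot_bracket_eq_act)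
  qed
  have "?d = 0 \<longleftrightarrow> (\<forall>x\<in>N. \<forall>y\<in>N. ?d [(x, 0), (y, 0)] = 0)"
  proof
    assume *: "\<forall>x\<in>N. \<forall>y\<in>N. ?d [(x, 0), (y, 0)] = 0"
    have "?d xs = 0" for xs
    proof (cases "length xs = 2 \<and> set xs \<subseteq> NH")
      case True
      then obtain x y where "xs = [(x, 0), (y, 0)]" "x \<in> N" "y \<in> N"
        by (auto simp: NH_eq length_Suc_conv numeral_2_eq_2)
      then show ?thesis using * by simp
    qed (rule outside)
    then show "?d = 0" by (simp add: fun_eq_iff)
  qed simp
  moreover have "?d [(x, 0), (y, 0)] = 0 \<longleftrightarrow> D (bracket x y) = cot_act x (D y) - cot_act y (D x)"
    if "x \<in> N" "y \<in> N" for x y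
    unfolding two[OF that] right_minus_eq by (rule eq_commute)
  ultimately show ?thesis by simp
qed

lemma map_of_cochain_of:
  assumes "\<And>x. x \<notin> N \<Longrightarrow> D x = 0"
  shows "map_of_cochain (cochain_of D) = D"
  using assms by (auto simp: map_of_cochain_def cochain_of_def NH_eq fun_eq_iff)

lemma cocycles_h_iff:
  "\<omega> \<in> cocycles_h l \<longleftrightarrow>
    \<omega> = cochain_of (map_of_cochain \<omega>) \<and> map_of_cochain \<omega> \<in> cot.cocycles l"
  using ce_diff_1_zero_iff[of \<omega> "map_of_cochain \<omega>"]
  unfolding mem_Collect_eq cochains_deg_1_iff cot.cocycles_def by blast

lemma bij_betw_map_of_cochain: "bij_betw map_of_cochain (cocycles_h l) (cot.cocycles l)"
proof (rule bij_betw_byWitness[where f' = cochain_of])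
  have "map_of_cochain (cochain_of D) = D" if "D \<in> cot.cocycles l" for D
    using that by (intro map_of_cochain_of) (simp add: cot.cocycles_def Hom_def)
  then show "\<forall>D\<in>cot.cocycles l. map_of_cochain (cochain_of D) = D"
    "cochain_of ` cot.cocycles l \<subseteq> cocycles_h l"
    unfolding image_subset_iff cocycles_h_iff by simp_all
  show "\<forall>\<omega>\<in>cocycles_h l. cochain_of (map_of_cochain \<omega>) = \<omega>"
    "map_of_cochain ` cocycles_h l \<subseteq> cot.cocycles l"
    unfolding image_subset_iff Ball_def cocycles_h_iff by simp_all
qed

lemma coboundaries_h:
  "ce_diff (cot_scale scale) (cot_bracket bracket) H ` cochains_deg (cot_scale scale) H 0 l =
    (\<lambda>m. cochain_of (cot.principal m)) ` H l"
proof -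
  define point :: "'a \<times> ('a \<Rightarrow> 'k) \<Rightarrow> ('a \<times> ('a \<Rightarrow> 'k)) list \<Rightarrow> 'a \<times> ('a \<Rightarrow> 'k)"
    where "point m xs = (if xs = [] then m else 0)" for m xs
  have iff: "\<omega> \<in> cochains_deg (cot_scale scale) H 0 l \<longleftrightarrow> \<omega> = point (\<omega> []) \<and> \<omega> [] \<in> H l" for \<omega>
    using cot.M.span_base[of "\<omega> []" "\<Union>i. H i"]
    by (auto simp: cochains_deg_def cochains_def point_def fun_eq_iff)
  have cochains: "cochains_deg (cot_scale scale) H 0 l = point ` H l"
  proof
    show "cochains_deg (cot_scale scale) H 0 l \<subseteq> point ` H l"
      by (rule subsetI, unfold iff, elim conjE, erule image_eqI)
    show "point ` H l \<subseteq> cochains_deg (cot_scale scale) H 0 l"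
      by (auto simp: iff) (simp_all add: point_def)
  qed
  have "ce_diff (cot_scale scale) (cot_bracket bracket) H (point m) xs = cochain_of (cot.principal m) xs"
    for m xs
  proof (cases "set xs \<subseteq> NH")
    case True
    consider "xs = []" | p where "xs = [p]" | p q ys where "xs = p # q # ys"
      by (metis list.exhaust)
    then show ?thesis
    proof cases
      case (2 p)
      moreover have "{(i, j). i < j \<and> j < Suc 0} = {}" by auto
      moreover obtain x where "p = (x, 0)" "x \<in> N" using True 2 by (auto simp: NH_eq)
      ultimately show ?thesis
        by (simp add: ce_diff_def cochain_of_def NH_eq drop_nth_def point_def cot.principal_def
            cot_bracket_eq_act)
    next
      case (3 p q ys)
      have "cot_bracket bracket (xs ! i) (point m (drop_nth i xs)) = 0" if i: "i < length xs" for i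
      proof -
        have "length (drop_nth i xs) > 0" using i 3 by (simp add: drop_nth_def)
        then have "point m (drop_nth i xs) = 0" by (auto simp: point_def)
        moreover obtain x where "xs ! i = (x, 0)"
          using True nth_mem[OF i] by (auto simp: NH_eq)
        ultimately show ?thesis by (simp add: cot_bracket_eq_act)
      qed
      then show ?thesis
        using 3 by (simp add: ce_diff_def cochain_of_def split_beta point_def)
    qed (simp add: ce_diff_def cochain_of_def)
  qed (simp add: ce_diff_def cochain_of_def)
  then have "ce_diff (cot_scale scale) (cot_bracket bracket) H (point m) = cochain_of (cot.principal m)"
    for m by blast
  then show ?thesis by (simp add: cochains image_image)
qed

section \<open>The isomorphisms\<close>

definition on_generators :: "(('a \<times> ('a \<Rightarrow> 'k)) list \<Rightarrow> 'a \<times> ('a \<Rightarrow> 'k)) \<Rightarrow> 'a \<Rightarrow> 'a \<times> ('a \<Rightarrow> 'k)"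
  where "on_generators \<omega> x = (if x \<in> G (- 1) then \<omega> [(x, 0)] else 0)"

definition g_part :: "(('a \<times> ('a \<Rightarrow> 'k)) list \<Rightarrow> 'a \<times> ('a \<Rightarrow> 'k)) \<Rightarrow> 'a \<Rightarrow> 'a" where
  "g_part \<omega> x = fst (on_generators \<omega> x)"

definition dual_part :: "(('a \<times> ('a \<Rightarrow> 'k)) list \<Rightarrow> 'a \<times> ('a \<Rightarrow> 'k)) \<Rightarrow> 'a \<Rightarrow> 'a \<Rightarrow> 'k" where
  "dual_part \<omega> x = snd (on_generators \<omega> x)"

lemma on_generators_eq: "on_generators = cot.generator_part \<circ> map_of_cochain"
  using G_in_N[of "- 1"]
  by (auto simp: on_generators_def cot.generator_part_def map_of_cochain_def fun_eq_iff)

lemma bij_betw_on_generators: "bij_betw on_generators (cocycles_h l) (cot.extendable l)"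
  unfolding on_generators_eq
  by (rule bij_betw_trans[OF bij_betw_map_of_cochain cot.bij_betw_generator_part])

lemma g_part_add: "g_part (\<omega> + \<omega>') = g_part \<omega> + g_part \<omega>'"
  and g_part_diff: "g_part (\<omega> - \<omega>') = g_part \<omega> - g_part \<omega>'"
  and dual_part_add: "dual_part (\<omega> + \<omega>') = dual_part \<omega> + dual_part \<omega>'"
  and dual_part_diff: "dual_part (\<omega> - \<omega>') = dual_part \<omega> - dual_part \<omega>'"
  and g_part_scale: "g_part (fun_scale (cot_scale scale) c \<omega>) = fun_scale scale c (g_part \<omega>)"
  and dual_part_scale:
    "dual_part (fun_scale (cot_scale scale) c \<omega>) = fun_scale (fun_scale (*)) c (dual_part \<omega>)"
  by (auto simp: g_part_def dual_part_def on_generators_def fun_eq_iff fun_scale_def cot_scale_def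
      split_beta)

lemma parts_image:
  assumes "l \<ge> 1"
  shows "(\<lambda>\<omega>. (g_part \<omega>, dual_part \<omega>)) ` cocycles_h l =
    (if l = 1 then S_space scale bracket G else {0}) \<times> Z_space scale bracket G l"
    (is "_ = ?S \<times> ?Z")
proof -
  let ?split = "\<lambda>\<alpha>. (\<lambda>x. fst (\<alpha> x), \<lambda>x. snd (\<alpha> x))"
  have "(f, \<phi>) \<in> ?split ` cot.extendable l" if "f \<in> ?S" "\<phi> \<in> ?Z" for f \<phi>
    using that extendable_iff[OF assms, of "\<lambda>x. (f x, \<phi> x)"]
    by (intro image_eqI[of _ _ "\<lambda>x. (f x, \<phi> x)"]) simp_all
  moreover have "?split \<alpha> \<in> ?S \<times> ?Z" if "\<alpha> \<in> cot.extendable l" for \<alpha>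
    using that extendable_iff[OF assms, of \<alpha>] by simp
  ultimately have "?split ` cot.extendable l = ?S \<times> ?Z" by blast
  moreover have "(\<lambda>\<omega>. (g_part \<omega>, dual_part \<omega>)) = ?split \<circ> on_generators"
    by (simp add: g_part_def dual_part_def fun_eq_iff)
  ultimately show ?thesis
    using bij_betw_on_generators[of l] by (simp only: image_comp[symmetric] bij_betw_def)
qed

lemma parts_inj:
  assumes "\<omega> \<in> cocycles_h l" "\<omega>' \<in> cocycles_h l" "g_part \<omega> = g_part \<omega>'" "dual_part \<omega> = dual_part \<omega>'"
  shows "\<omega> = \<omega>'"
proof -
  have "on_generators \<omega> x = on_generators \<omega>' x" for x
    using assms(3,4)[THEN fun_cong, of x] by (simp add: g_part_def dual_part_def prod_eq_iff)
  then show ?thesis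
    using bij_betw_on_generators[of l] assms(1,2) unfolding bij_betw_def inj_on_def by blast
qed

lemma vector_space_cochains: "vector_space (fun_scale (cot_scale scale))"
  by (rule vector_space_fun_scale) unfold_locales

lemma subspace_cocycles_h: "module.subspace (fun_scale (cot_scale scale)) (cocycles_h l)"
proof -
  interpret F: vector_space "fun_scale (cot_scale scale)" by (rule vector_space_cochains)
  note sub = cot.subspace_cocycles[of l]
  have eq: "cochain_of (D + E) = cochain_of D + cochain_of E"
    "cochain_of (fun_scale (cot_scale scale) c D) = fun_scale (cot_scale scale) c (cochain_of D)"
    "cochain_of 0 = 0" for D E c
    by (simp_all add: fun_eq_iff cochain_of_def fun_scale_def)
  have img: "cocycles_h l = cochain_of ` cot.cocycles l"
  proof
    show "cochain_of ` cot.cocycles l \<subseteq> cocycles_h l"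
      unfolding image_subset_iff cocycles_h_iff
      using map_of_cochain_of by (simp add: cot.cocycles_def Hom_def)
    show "cocycles_h l \<subseteq> cochain_of ` cot.cocycles l"
      by (rule subsetI, unfold cocycles_h_iff, elim conjE, erule image_eqI)
  qed
  show ?thesis
    unfolding img
    using F.subspace_0[OF sub] F.subspace_add[OF sub] F.subspace_scale[OF sub]
    by (intro F.subspaceI) (force simp flip: eq)+
qed

lemma vector_space_Z: "vector_space (fun_scale (fun_scale ((*) :: 'k \<Rightarrow> 'k \<Rightarrow> 'k)))"
  by (rule vector_space_fun_scale[OF vector_space_fun_scale_field])

lemma subspace_B: "module.subspace (fun_scale (fun_scale (*))) (B_space scale bracket G l)"
proof -
  interpret F: vector_space "fun_scale ((*) :: 'k \<Rightarrow> 'k \<Rightarrow> 'k)"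
    by (rule vector_space_fun_scale_field)
  interpret FF: vector_space "fun_scale (fun_scale ((*) :: 'k \<Rightarrow> 'k \<Rightarrow> 'k))"
    by (rule vector_space_Z)
  note sub = subspace_dual_comp[of "- l"]
  have eq: "hat bracket G (\<beta> + \<gamma>) = hat bracket G \<beta> + hat bracket G \<gamma>"
    "hat bracket G (fun_scale (*) c \<beta>) = fun_scale (fun_scale (*)) c (hat bracket G \<beta>)"
    "hat bracket G 0 = 0" for \<beta> \<gamma> :: "'a \<Rightarrow> 'k" and c
    by (simp_all add: fun_eq_iff hat_def fun_scale_def)
  show ?thesis
    unfolding B_space_def
    using F.subspace_0[OF sub] F.subspace_add[OF sub] F.subspace_scale[OF sub]
    by (intro FF.subspaceI) (force simp flip: eq)+
qed

text \<open>For \<open>l \<ge> 1\<close> the space \<open>h\<^sub>l\<close> consists of functionals \<open>\<beta>\<close>, and the restriction of the coboundary of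
  \<open>\<beta>\<close> to the generators is \<open>hat bracket G \<beta>\<close>. Conversely, a cocycle with this restriction is the
  coboundary of \<open>\<beta>\<close>, since cocycles are determined by their restrictions.\<close>

lemma coboundaries_h_iff:
  assumes "l \<ge> 1"
  shows "ce_diff (cot_scale scale) (cot_bracket bracket) H ` cochains_deg (cot_scale scale) H 0 l =
    {\<omega> \<in> cocycles_h l. g_part \<omega> = 0 \<and> dual_part \<omega> \<in> B_space scale bracket G l}"
    (is "_ = ?W")
proof -
  let ?c = "\<lambda>\<beta>. cochain_of (cot.principal (0, \<beta>))"
  have Hl: "H l = {0} \<times> dual_comp scale G (- l)"
    using assms by (simp add: cot_grading_def)
  have cocycle: "?c \<beta> \<in> cocycles_h l" if "\<beta> \<in> dual_comp scale G (- l)" for \<beta>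
  proof -
    have "cot.principal (0, \<beta>) \<in> cot.cocycles l"
      using that by (intro cot.principal_cocycle) (simp add: Hl)
    moreover from this have "map_of_cochain (?c \<beta>) = cot.principal (0, \<beta>)"
      by (intro map_of_cochain_of) (simp add: cot.cocycles_def Hom_def)
    ultimately show ?thesis unfolding cocycles_h_iff by simp
  qed
  have parts: "g_part (?c \<beta>) = 0" "dual_part (?c \<beta>) = hat bracket G \<beta>" for \<beta>
    using G_in_N[of "- 1"]
    by (auto simp: g_part_def dual_part_def on_generators_def cochain_of_def NH_eq
        cot.principal_def cot_act_pair hat_def coad_def fun_eq_iff)
  have "ce_diff (cot_scale scale) (cot_bracket bracket) H ` cochains_deg (cot_scale scale) H 0 l =
      ?c ` dual_comp scale G (- l)"
    unfolding coboundaries_h Hl by force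
  also have "\<dots> = ?W"
  proof
    show "?c ` dual_comp scale G (- l) \<subseteq> ?W"
      using cocycle parts by (auto simp: B_space_def)
    show "?W \<subseteq> ?c ` dual_comp scale G (- l)"
    proof
      fix \<omega> assume \<omega>: "\<omega> \<in> ?W"
      then obtain \<beta> where \<beta>: "\<beta> \<in> dual_comp scale G (- l)" "dual_part \<omega> = hat bracket G \<beta>"
        by (auto simp: B_space_def)
      have "\<omega> = ?c \<beta>"
        using \<omega> \<beta> cocycle[OF \<beta>(1)] by (intro parts_inj[of _ l]) (simp_all add: parts)
      then show "\<omega> \<in> ?c ` dual_comp scale G (- l)" using \<beta>(1) by blast
    qed
  qed
  finally show ?thesis .
qed

lemma cohomology_iso:
  assumes l: "l \<ge> 1"
    and surj: "\<Phi> ` cocycles_h l = vcarrier F"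
    and add: "\<And>\<omega> \<omega>'. \<Phi> (\<omega> + \<omega>') = vadd F (\<Phi> \<omega>) (\<Phi> \<omega>')"
    and smult: "\<And>c \<omega>. \<Phi> (fun_scale (cot_scale scale) c \<omega>) = vsmult F c (\<Phi> \<omega>)"
    and ker: "\<And>\<omega> \<omega>'. \<omega> \<in> cocycles_h l \<Longrightarrow> \<omega>' \<in> cocycles_h l \<Longrightarrow> \<Phi> \<omega> = \<Phi> \<omega>' \<longleftrightarrow>
      g_part \<omega> = g_part \<omega>' \<and> dual_part \<omega> - dual_part \<omega>' \<in> B_space scale bracket G l"
  shows "vs_iso (cohomology (cot_scale scale) (cot_bracket bracket) H 1 l) F"
proof -
  interpret F: vector_space "fun_scale (cot_scale scale)" by (rule vector_space_cochains)
  interpret Z: vector_space "fun_scale (fun_scale ((*) :: 'k \<Rightarrow> 'k \<Rightarrow> 'k))"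
    by (rule vector_space_Z)
  let ?B = "B_space scale bracket G l"
  define W where "W = {\<omega> \<in> cocycles_h l. g_part \<omega> = 0 \<and> dual_part \<omega> \<in> ?B}"
  note sub = subspace_cocycles_h[of l]
  have zero: "g_part 0 = 0" "dual_part 0 = 0"
    using g_part_diff[of 0 0] dual_part_diff[of 0 0] by simp_all
  have "fun_scale scale c 0 = (0 :: 'a \<Rightarrow> 'a)" for c by (simp add: fun_scale_def fun_eq_iff)
  then have W: "F.subspace W"
    unfolding W_def
    using F.subspace_0[OF sub] F.subspace_add[OF sub] F.subspace_scale[OF sub]
      Z.subspace_0[OF subspace_B] Z.subspace_add[OF subspace_B] Z.subspace_scale[OF subspace_B]
    by (intro F.subspaceI)
      (simp_all add: zero g_part_add dual_part_add g_part_scale dual_part_scale)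
  have "vs_iso (vquotient (fun_scale (cot_scale scale)) (cocycles_h l) W) F"
  proof (rule vquotient_iso[OF vector_space_cochains sub W _ surj])
    show "W \<subseteq> cocycles_h l" unfolding W_def by blast
    show "\<Phi> \<omega> = \<Phi> \<omega>' \<longleftrightarrow> \<omega> - \<omega>' \<in> W" if "\<omega> \<in> cocycles_h l" "\<omega>' \<in> cocycles_h l" for \<omega> \<omega>'
      using F.subspace_diff[OF sub that] ker[OF that]
      unfolding W_def by (simp add: g_part_diff dual_part_diff)
  qed (rule add smult)+
  then show ?thesis
    by (simp add: cohomology_def coboundaries_h_iff[OF l] W_def)
qed

theorem cohomology_degree_1:
  "vs_iso (cohomology (cot_scale scale) (cot_bracket bracket) H 1 1)
     (vsum (as_vspace (fun_scale scale) (S_space scale bracket G))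
       (vquotient (fun_scale (fun_scale (*)))
         (Z_space scale bracket G 1) (B_space scale bracket G 1)))"
    (is "vs_iso _ (vsum (as_vspace _ ?S) (vquotient _ ?Z ?B))")
proof (rule cohomology_iso[where \<Phi> = "\<lambda>\<omega>. (g_part \<omega>, dual_part \<omega> +o ?B)"])
  note B = vector_space_Z subspace_B[of 1]
  have "(\<lambda>\<omega>. (g_part \<omega>, dual_part \<omega> +o ?B)) ` cocycles_h 1 =
      map_prod id (\<lambda>\<phi>. \<phi> +o ?B) ` (\<lambda>\<omega>. (g_part \<omega>, dual_part \<omega>)) ` cocycles_h 1"
    by (simp only: image_image map_prod_simp id_apply)
  also have "\<dots> = ?S \<times> (\<lambda>\<phi>. \<phi> +o ?B) ` ?Z"
    unfolding parts_image[OF order_refl] by (rule map_prod_surj_on) simp_all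
  finally show "(\<lambda>\<omega>. (g_part \<omega>, dual_part \<omega> +o ?B)) ` cocycles_h 1 =
      vcarrier (vsum (as_vspace (fun_scale scale) ?S) (vquotient (fun_scale (fun_scale (*))) ?Z ?B))"
    by (simp add: vsum_def as_vspace_def vquotient_def)
qed (simp_all add: vsum_def as_vspace_def vquotient_def g_part_add dual_part_add g_part_scale
    dual_part_scale coset_eq_iff[OF vector_space_Z subspace_B]
    coset_add[OF vector_space_Z subspace_B] coset_scale[OF vector_space_Z subspace_B])

theorem cohomology_degree_ge_2:
  assumes "l \<ge> 2"
  shows "vs_iso (cohomology (cot_scale scale) (cot_bracket bracket) H 1 l)
    (vquotient (fun_scale (fun_scale (*))) (Z_space scale bracket G l) (B_space scale bracket G l))"
    (is "vs_iso _ (vquotient _ ?Z ?B)")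
proof (rule cohomology_iso[where \<Phi> = "\<lambda>\<omega>. dual_part \<omega> +o ?B"])
  have parts: "(\<lambda>\<omega>. (g_part \<omega>, dual_part \<omega>)) ` cocycles_h l = {0} \<times> ?Z"
    using parts_image[of l] assms by simp
  have "(\<lambda>\<omega>. dual_part \<omega> +o ?B) ` cocycles_h l =
      (\<lambda>p. snd p +o ?B) ` (\<lambda>\<omega>. (g_part \<omega>, dual_part \<omega>)) ` cocycles_h l"
    by (simp only: image_image snd_conv)
  also have "\<dots> = (\<lambda>\<phi>. \<phi> +o ?B) ` ?Z" unfolding parts by force
  finally show "(\<lambda>\<omega>. dual_part \<omega> +o ?B) ` cocycles_h l =
      vcarrier (vquotient (fun_scale (fun_scale (*))) ?Z ?B)"
    by (simp add: vquotient_def)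
  fix \<omega> \<omega>' assume "\<omega> \<in> cocycles_h l" "\<omega>' \<in> cocycles_h l"
  then have "(g_part \<omega>, dual_part \<omega>) \<in> {0} \<times> ?Z" "(g_part \<omega>', dual_part \<omega>') \<in> {0} \<times> ?Z"
    unfolding parts[symmetric] by blast+
  then show "dual_part \<omega> +o ?B = dual_part \<omega>' +o ?B \<longleftrightarrow>
      g_part \<omega> = g_part \<omega>' \<and> dual_part \<omega> - dual_part \<omega>' \<in> ?B"
    by (simp add: coset_eq_iff[OF vector_space_Z subspace_B])
qed (use assms in \<open>simp_all add: vquotient_def dual_part_add dual_part_scale
    coset_add[OF vector_space_Z subspace_B] coset_scale[OF vector_space_Z subspace_B]\<close>)

end

theorem theorem3:
  fixes scale :: "'k::field \<Rightarrow> 'a::ab_group_add \<Rightarrow> 'a"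
    and bracket :: "'a \<Rightarrow> 'a \<Rightarrow> 'a"
    and k :: int
    and G :: "int \<Rightarrow> 'a set"
  assumes "fundamental_lie_algebra scale bracket k G"
  shows "vs_iso
           (cohomology (cot_scale scale) (cot_bracket bracket) (cot_grading scale G) 1 1)
           (vsum (as_vspace (fun_scale scale) (S_space scale bracket G))
                 (vquotient (fun_scale (fun_scale (*)))
                    (Z_space scale bracket G 1) (B_space scale bracket G 1))) \<and>
         (\<forall>l\<ge>2. vs_iso
           (cohomology (cot_scale scale) (cot_bracket bracket) (cot_grading scale G) 1 l)
           (vquotient (fun_scale (fun_scale (*)))
              (Z_space scale bracket G l) (B_space scale bracket G l)))"
proof -
  interpret fundamental_lie_algebra scale bracket k G by fact
  show ?thesis using cohomology_degree_1 cohomology_degree_ge_2 by blast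
qed

end
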